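(* Let $K_1, K_2$ be Eberlein compact spaces of height $\omega+1$ and let $E$ be a Banach space not containing an isomorphic copy of $c_0$. If $\mathcal{C}(K_1)$ is isomorphic to a subspace of $\mathcal{C}(K_2,E)$, then $$\lim_{n\to\infty}\left|K_1^{(n)}\right|\le\lim_{n\to\infty}\left|K_2^{(n)}\right|.$$
   Context: All topological spaces are Hausdorff. A compact space is Eberlein if it is homeomorphic to a weakly compact subset of a Banach space. For a compact space $K$ and a Banach space $E$, $\mathcal{C}(K,E)$ is the Banach space of continuous functions $K\to E$ with the sup-norm, and $\mathcal{C}(K)=\mathcal{C}(K,\mathbb{R})$. Isomorphic means linearly homeomorphic. Cantor-Bendixson derivatives: $X^{(0)}=X$, $X^{(1)}$ is the set of accumulation points of $X$, $X^{(\beta+1)}=(X^{(\beta)})^{(1)}$, and $X^{(\alpha)}=\bigcap_{\beta<\alpha}X^{(\beta)}$ for limit ordinals $\alpha$. The height of a scattered space $X$ is the minimal ordinal $\alpha$ with $X^{(\alpha)}=\emptyset$ (a space is scattered if such an $\alpha$ exists). $|A|$ denotes the cardinality of $A$; the limits are the eventual values of the nonincreasing (hence eventually constant) sequences of cardinals $|K_i^{(n)}|$, $n\in\mathbb{N}$. *)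

theory Defs
  imports "HOL-Analysis.Analysis"
begin

unbundle cardinal_syntax

section \<open>Cantor-Bendixson derivatives and height\<close>

definition accumulation_points :: "'a::topological_space set \<Rightarrow> 'a set" where
  "accumulation_points X = {x \<in> X. x islimpt X}"

text \<open>
  \<open>cb_deriv X m n\<close> is the derivative of \<open>X\<close> of order \<open>\<omega> \<cdot> m + n\<close>. The pairs \<open>(m, n)\<close>, ordered
  lexicographically, represent exactly the ordinals below \<open>\<omega>\<^sup>2\<close>; in particular
  \<open>cb_deriv X 0 n\<close> is the derivative of finite order \<open>n\<close>.
\<close>

function cb_deriv :: "'a::topological_space set \<Rightarrow> nat \<Rightarrow> nat \<Rightarrow> 'a set" where
  "cb_deriv X 0 0 = X"
| "cb_deriv X m (Suc n) = accumulation_points (cb_deriv X m n)"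
| "cb_deriv X (Suc m) 0 = (\<Inter>i\<in>{..m}. \<Inter>n. cb_deriv X i n)"
  by pat_completeness auto
termination
  by (relation "inv_image (less_than <*lex*> less_than) (\<lambda>(X, m, n). (m, n))") auto

text \<open>\<open>has_height X m n\<close>: the least ordinal at which the derivative of \<open>X\<close> is empty is \<open>\<omega> \<cdot> m + n\<close>.\<close>

definition has_height :: "'a::topological_space set \<Rightarrow> nat \<Rightarrow> nat \<Rightarrow> bool" where
  "has_height X m n \<longleftrightarrow>
     cb_deriv X m n = {} \<and> (\<forall>i j. i < m \<or> i = m \<and> j < n \<longrightarrow> cb_deriv X i j \<noteq> {})"

section \<open>Eberlein compact spaces\<close>

definition weak_topology :: "'x::real_normed_vector topology" where
  "weak_topology = topology_generated_by {f -` U | (f :: 'x \<Rightarrow> real) U. bounded_linear f \<and> open U}"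

text \<open>
  The ambient Banach space cannot be existentially quantified inside a definition, so its type is
  a parameter: \<open>'k\<close> is Eberlein compact iff the following holds for some Banach space \<open>'x\<close>.
  As a hypothesis this existential becomes a universally quantified type variable.
\<close>

definition eberlein_compact :: "'k::t2_space itself \<Rightarrow> 'x::banach itself \<Rightarrow> bool" where
  "eberlein_compact _ _ \<longleftrightarrow>
     compact (UNIV :: 'k set) \<and>
     (\<exists>W :: 'x set. compactin weak_topology W \<and>
        (euclidean :: 'k topology) homeomorphic_space subtopology weak_topology W)"

section \<open>Isomorphisms and \<open>c\<^sub>0\<close>\<close>

definition linearly_homeomorphic ::
    "'x::real_normed_vector set \<Rightarrow> 'y::real_normed_vector set \<Rightarrow> bool" where
  "linearly_homeomorphic S T \<longleftrightarrow>
     subspace S \<and> subspace T \<and>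
     (\<exists>f g. homeomorphism S T f g \<and>
        (\<forall>x\<in>S. \<forall>y\<in>S. f (x + y) = f x + f y) \<and>
        (\<forall>c. \<forall>x\<in>S. f (c *\<^sub>R x) = c *\<^sub>R f x))"

definition c0 :: "(nat \<Rightarrow>\<^sub>C real) set" where
  "c0 = {x. apply_bcontfun x \<longlonglongrightarrow> 0}"

section \<open>Limits of sequences of cardinals\<close>

text \<open>Cardinals are represented by cardinal orders, determined up to \<open>=o\<close>.\<close>

definition eventual_card :: "(nat \<Rightarrow> 'a set) \<Rightarrow> 'a rel \<Rightarrow> bool" where
  "eventual_card A \<kappa> \<longleftrightarrow> (\<forall>\<^sub>F n in sequentially. |A n| =o \<kappa>)"

end

theory Submission
  imports Defs
begin

text \<open>
  Suppose \<open>|K\<^sub>2\<^sup>(\<^sup>n\<^sup>)|\<close> is eventually smaller than \<open>|K\<^sub>1\<^sup>(\<^sup>n\<^sup>)|\<close>, fix \<open>n\<close> with \<open>L = K\<^sub>2\<^sup>(\<^sup>n\<^sup>)\<close> of eventual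
  size, and let \<open>T\<close> be the embedding. For \<open>y \<in> L\<close> the finitely additive map \<open>V \<mapsto> T 1\<^sub>V y\<close> on clopen
  sets is exhaustive, as \<open>E\<close> does not contain \<open>c\<^sub>0\<close>, so it lives on a countable set. The union \<open>S\<close> of
  these sets has at most \<open>|L|\<close> points, and so does its closure, as \<open>K\<^sub>1\<close> is Eberlein and scattered.
  Hence for every \<open>N\<close> some clopen \<open>U\<close> off \<open>S\<close> meets \<open>K\<^sub>1\<^sup>(\<^sup>N\<^sup>)\<close>, and \<open>T f\<close> vanishes on \<open>L\<close> when
  \<open>f\<close> is supported in \<open>U\<close>. Descending through the derivatives of \<open>K\<^sub>1\<close>, choose clopen sets
  \<open>U \<supseteq> V\<^sub>0 \<supseteq> \<dots> \<supseteq> V\<^sub>N \<noteq> {}\<close> such that at every point of \<open>K\<^sub>2\<close> at most \<open>n\<close> of the \<open>T 1\<^bsub>V j\<^esub>\<close> are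
  larger than a small \<open>\<epsilon>\<close>. Then \<open>\<Sum>j\<le>N. 1\<^bsub>V j\<^esub>\<close> has norm \<open>N + 1\<close> but an image of norm at most
  \<open>n \<parallel>T\<parallel> + (N + 1) \<epsilon>\<close>, which is absurd for large \<open>N\<close>.
\<close>

section \<open>The Hahn-Banach theorem\<close>

definition sublinear :: "('a::real_vector \<Rightarrow> real) \<Rightarrow> bool" where
  "sublinear q \<longleftrightarrow> (\<forall>x y. q (x + y) \<le> q x + q y) \<and> (\<forall>c x. c \<ge> 0 \<longrightarrow> q (c *\<^sub>R x) = c * q x)"

text \<open>Applied with \<open>inverse c\<close> to \<open>c *\<^sub>R x\<close>, the inequality
  turns around, so an upper bound for positive \<open>c\<close> is enough.\<close>

lemma sublinearI:
  assumes "\<And>x y. q (x + y) \<le> q x + q y" "\<And>c x. c > 0 \<Longrightarrow> q (c *\<^sub>R x) \<le> c * q x" "q 0 = 0"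
  shows "sublinear q"
proof -
  have "q (c *\<^sub>R x) = c * q x" if "c \<ge> 0" for c x
  proof (cases "c = 0")
    case False
    with that have c: "c > 0" by simp
    have "q x \<le> inverse c * q (c *\<^sub>R x)"
      using assms(2)[of "inverse c" "c *\<^sub>R x"] c by simp
    then have "c * q x \<le> q (c *\<^sub>R x)"
      using c by (simp add: field_simps)
    with assms(2)[OF c] show ?thesis by (simp add: antisym)
  qed (simp add: assms)
  with assms show ?thesis by (simp add: sublinear_def)
qed

lemma sublinear_zero: "sublinear q \<Longrightarrow> q 0 = 0"
  unfolding sublinear_def by (metis mult_zero_left order_refl scaleR_zero_left)

lemma sublinear_add: "sublinear q \<Longrightarrow> q (x + y) \<le> q x + q y"
  by (simp add: sublinear_def)

lemma sublinear_scaleR: "sublinear q \<Longrightarrow> c \<ge> 0 \<Longrightarrow> q (c *\<^sub>R x) = c * q x"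
  by (simp add: sublinear_def)

lemma sublinear_minus: "sublinear q \<Longrightarrow> - q (- x) \<le> q x"
  using sublinear_add[of q x "- x"] sublinear_zero[of q] by simp

text \<open>The bound \<open>- p (- x)\<close> keeps the infimum finite. For subadditivity, any two
  members of the chain lie above the smaller of them. This supplies the lower bounds in Zorn's
  lemma.\<close>

lemma sublinear_chain_INF:
  assumes C: "C \<noteq> {}" "\<And>q. q \<in> C \<Longrightarrow> sublinear q \<and> q \<le> p"
    and chain: "\<And>q q'. q \<in> C \<Longrightarrow> q' \<in> C \<Longrightarrow> q \<le> q' \<or> q' \<le> q"
  shows "sublinear (\<lambda>x. INF q\<in>C. q x)" and "\<And>q. q \<in> C \<Longrightarrow> (\<lambda>x. INF q\<in>C. q x) \<le> q"
proof -
  have low: "- p (- x) \<le> q x" if "q \<in> C" for q x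
    using sublinear_minus[of q x] C(2)[OF that] by (metis le_funE neg_le_iff_le order_trans)
  have bdd: "bdd_below ((\<lambda>q. q x) ` C)" for x
    using low by (intro bdd_belowI2)
  have le: "(INF q\<in>C. q x) \<le> q x" if "q \<in> C" for q x
    using bdd that by (rule cINF_lower)
  then show "(\<lambda>x. INF q\<in>C. q x) \<le> q" if "q \<in> C" for q
    using that by (simp add: le_fun_def)
  show "sublinear (\<lambda>x. INF q\<in>C. q x)"
  proof (rule sublinearI)
    fix x y
    have "(INF q\<in>C. q (x + y)) - q' y \<le> q x" if qC: "q \<in> C" "q' \<in> C" for q q'
    proof -
      obtain r where r: "r \<in> C" "r \<le> q" "r \<le> q'"
        using chain[OF qC] qC by (meson order_refl)
      have "(INF q\<in>C. q (x + y)) \<le> r x + r y"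
        using le[OF r(1), of "x + y"] C(2)[OF r(1)] sublinear_add[of r x y] by linarith
      also have "\<dots> \<le> q x + q' y"
        using r by (intro add_mono) (auto simp: le_fun_def)
      finally show ?thesis by simp
    qed
    then have "(INF q\<in>C. q (x + y)) - q' y \<le> (INF q\<in>C. q x)" if "q' \<in> C" for q'
      using C(1) that by (intro cINF_greatest)
    then have "(INF q\<in>C. q (x + y)) - (INF q\<in>C. q x) \<le> (INF q\<in>C. q y)"
      using C(1) by (intro cINF_greatest) (auto simp: algebra_simps)
    then show "(INF q\<in>C. q (x + y)) \<le> (INF q\<in>C. q x) + (INF q\<in>C. q y)" by simp
  next
    fix c :: real and x :: 'a assume c: "c > 0"
    have "(INF q\<in>C. q (c *\<^sub>R x)) / c \<le> q x" if "q \<in> C" for q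
      using le[OF that, of "c *\<^sub>R x"] C(2)[OF that] c sublinear_scaleR[of q c x] by (simp add: field_simps)
    then have "(INF q\<in>C. q (c *\<^sub>R x)) / c \<le> (INF q\<in>C. q x)"
      using C(1) by (intro cINF_greatest)
    then show "(INF q\<in>C. q (c *\<^sub>R x)) \<le> c * (INF q\<in>C. q x)"
      using c by (simp add: field_simps)
  next
    have "(\<lambda>q. q 0) ` C = {0}"
      using C sublinear_zero by fastforce
    then show "(INF q\<in>C. q 0) = 0" by simp
  qed
qed

text \<open>Take the infimum of \<open>q (x + t *\<^sub>R a) - t * q a\<close> over
  \<open>t \<ge> 0\<close>: \<open>t = 0\<close> gives \<open>r \<le> q\<close> and
  \<open>t = 1\<close> the last conclusion. If \<open>q\<close> is minimal, then
  \<open>r = q\<close> and the last conclusion becomes superadditivity.\<close>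

lemma sublinear_shift:
  assumes q: "sublinear q"
  obtains r where "sublinear r" "r \<le> q" "\<And>x. r x \<le> q (x + a) - q a"
proof
  define r where "r x = (INF t\<in>{0::real..}. q (x + t *\<^sub>R a) - t * q a)" for x
  have low: "- q (- x) \<le> q (x + t *\<^sub>R a) - t * q a" if "t \<ge> 0" for t x
    using sublinear_add[OF q, of "x + t *\<^sub>R a" "- x"] sublinear_scaleR[OF q that, of a] by simp
  have le: "r x \<le> q (x + t *\<^sub>R a) - t * q a" if "t \<ge> 0" for x t
    unfolding r_def using that low by (intro cINF_lower bdd_belowI2[where m = "- q (- x)"]) auto
  show "r \<le> q" using le[of 0] by (simp add: le_fun_def)
  show "r x \<le> q (x + a) - q a" for x using le[of 1 x] by simp
  show "sublinear r"
  proof (rule sublinearI)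
    fix x y
    have "r (x + y) - (q (y + s *\<^sub>R a) - s * q a) \<le> q (x + t *\<^sub>R a) - t * q a" if "t \<ge> 0" "s \<ge> 0" for s t
      using le[of "s + t" "x + y"] sublinear_add[OF q, of "x + t *\<^sub>R a" "y + s *\<^sub>R a"] that
      by (simp add: algebra_simps)
    then have "r (x + y) - (q (y + s *\<^sub>R a) - s * q a) \<le> r x" if "s \<ge> 0" for s
      unfolding r_def[of x] using that by (intro cINF_greatest) auto
    then have "r (x + y) - r x \<le> q (y + s *\<^sub>R a) - s * q a" if "s \<ge> 0" for s
      using that by (smt (verit))
    then have "r (x + y) - r x \<le> r y"
      unfolding r_def[of y] by (intro cINF_greatest) auto
    then show "r (x + y) \<le> r x + r y" by simp
  next
    fix c :: real and x assume c: "c > 0"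
    have "r (c *\<^sub>R x) / c \<le> q (x + t *\<^sub>R a) - t * q a" if "t \<ge> 0" for t
      using le[of "c * t" "c *\<^sub>R x"] sublinear_scaleR[OF q, of c "x + t *\<^sub>R a"] c that
      by (simp add: field_simps)
    then have "r (c *\<^sub>R x) / c \<le> r x"
      unfolding r_def[of x] by (intro cINF_greatest) auto
    then show "r (c *\<^sub>R x) \<le> c * r x"
      using c by (simp add: field_simps)
  next
    have "(\<lambda>t. q (0 + t *\<^sub>R a) - t * q a) ` {0..} = {0}"
      using sublinear_scaleR[OF q] by (force simp: image_def)
    then show "r 0 = 0" unfolding r_def by simp
  qed
qed

text \<open>A minimal sublinear functional is linear, because shifting it does not decrease it.\<close>

theorem hahn_banach_sublinear:
  fixes p :: "'a::real_vector \<Rightarrow> real"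
  assumes p: "sublinear p"
  obtains f where "linear f" "\<And>x. f x \<le> p x" "f z = p z"
proof -
  \<comment> \<open>After this shift every functional below \<open>p'\<close> is at most
    \<open>- p z\<close> at \<open>- z\<close>, which forces equality at \<open>z\<close> once it is
    linear.\<close>
  obtain p' where p': "sublinear p'" "p' \<le> p" "\<And>x. p' x \<le> p (x + z) - p z"
    using sublinear_shift[OF p] by blast
  define A where "A = {q. sublinear q \<and> q \<le> p'}"
  have "\<exists>m\<in>A. \<forall>a\<in>A. a \<le> m \<longrightarrow> a = m"
  \<comment> \<open>The order is reversed, so the maximal element is a minimal sublinear
    functional.\<close>
  proof (rule predicate_Zorn[where P = "\<lambda>q q'. q' \<le> q"])
    show "partial_order_on A (relation_of (\<lambda>q q'. q' \<le> q) A)"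
      by (rule partial_order_on_relation_ofI) auto
    fix C assume "C \<in> Chains (relation_of (\<lambda>q q'. q' \<le> q) A)"
    then have C: "C \<subseteq> A" "\<And>q q'. q \<in> C \<Longrightarrow> q' \<in> C \<Longrightarrow> q \<le> q' \<or> q' \<le> q"
      by (auto simp: Chains_def relation_of_def)
    show "\<exists>u\<in>A. \<forall>a\<in>C. u \<le> a"
    proof (cases "C = {}")
      case True
      then show ?thesis using p' by (auto simp: A_def)
    next
      case False
      have CA: "sublinear q \<and> q \<le> p'" if "q \<in> C" for q
        using C(1) that by (auto simp: A_def)
      have I: "sublinear (\<lambda>x. INF q\<in>C. q x)" "\<And>q. q \<in> C \<Longrightarrow> (\<lambda>x. INF q\<in>C. q x) \<le> q"
        by (rule sublinear_chain_INF[of C p']; use False CA C(2) in blast)+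
      obtain q where q: "q \<in> C" using False by blast
      have "(\<lambda>x. INF q\<in>C. q x) \<le> p'"
        using order_trans[OF I(2)[OF q]] CA[OF q] by blast
      with I(1) have "(\<lambda>x. INF q\<in>C. q x) \<in> A" by (simp add: A_def)
      with I(2) show ?thesis by blast
    qed
  qed
  then obtain f where f: "sublinear f" "f \<le> p'" and min: "\<And>q. sublinear q \<Longrightarrow> q \<le> f \<Longrightarrow> q = f"
    unfolding A_def by (smt (verit, best) mem_Collect_eq order_trans)
  have add: "f (x + a) = f x + f a" for x a
  proof -
    obtain r where "sublinear r" "r \<le> f" "\<And>x. r x \<le> f (x + a) - f a"
      using sublinear_shift[OF f(1)] by blast
    then have "f x \<le> f (x + a) - f a" using min by metis
    with sublinear_add[OF f(1), of x a] show ?thesis by simp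
  qed
  have neg: "f (- x) = - f x" for x
    using add[of x "- x"] sublinear_zero[OF f(1)] by simp
  have "linear f"
  proof (rule linearI)
    fix c :: real and x
    show "f (c *\<^sub>R x) = c *\<^sub>R f x"
    proof (cases "c \<ge> 0")
      case False
      then show ?thesis using sublinear_scaleR[OF f(1), of "- c" x] neg[of "c *\<^sub>R x"] by simp
    qed (simp add: sublinear_scaleR[OF f(1)])
  qed (rule add)
  moreover have fp: "f x \<le> p x" for x
    using f(2) p'(2) by (metis le_funE order_trans)
  moreover have "f (- z) \<le> - p z"
    using f(2) p'(3)[of "- z"] sublinear_zero[OF p] by (metis add.left_inverse diff_0 le_funE order_trans)
  then have "f z = p z" using neg[of z] fp[of z] by simp
  ultimately show thesis using that by blast
qed

section \<open>Norming and annihilating functionals\<close>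

lemma bounded_linear_le_norm:
  fixes f :: "'a::real_normed_vector \<Rightarrow> real"
  assumes "linear f" "\<And>x. f x \<le> norm x"
  shows "\<bar>f x\<bar> \<le> norm x" "bounded_linear f"
proof -
  show *: "\<bar>f x\<bar> \<le> norm x" for x
    using assms(2)[of x] assms(2)[of "- x"] linear_neg[OF assms(1), of x] by simp
  show "bounded_linear f"
    using * by (intro bounded_linear.intro bounded_linear_axioms.intro assms(1) exI[of _ 1]) simp
qed

lemma norming_functional:
  fixes z :: "'a::real_normed_vector"
  obtains f where "bounded_linear f" "\<And>x. \<bar>f x\<bar> \<le> norm x" "f z = norm z"
proof -
  have "sublinear (norm :: 'a \<Rightarrow> real)"
    by (rule sublinearI) (auto simp: norm_triangle_ineq)
  then obtain f where "linear f" "\<And>x. f x \<le> norm x" "f z = norm z"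
    using hahn_banach_sublinear by blast
  with bounded_linear_le_norm that show thesis by blast
qed

text \<open>The distance to \<open>Y\<close> is sublinear, at most the norm, zero on
  \<open>Y\<close> and positive at \<open>z\<close>. A linear functional below it with the same
  value at \<open>z\<close> has all the required properties.\<close>

lemma annihilating_functional:
  fixes Y :: "'a::real_normed_vector set"
  assumes Y: "subspace Y" and z: "z \<notin> closure Y"
  obtains f where "bounded_linear f" "\<And>y. y \<in> Y \<Longrightarrow> f y = (0::real)" "f z \<noteq> 0"
proof -
  have ne: "Y \<noteq> {}" using subspace_0[OF Y] by auto
  have "sublinear (\<lambda>x. infdist x Y)"
  proof (rule sublinearI)
    fix x y
    have "infdist (x + y) Y - dist y b \<le> dist x a" if "a \<in> Y" "b \<in> Y" for a b
      using infdist_le2[of "a + b" Y "x + y" "dist x a + dist y b"] subspace_add[OF Y] that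
        dist_triangle_add[of x y a b] by simp
    then have "infdist (x + y) Y - dist y b \<le> infdist x Y" if "b \<in> Y" for b
      using ne that by (simp add: infdist_notempty cINF_greatest)
    then have "infdist (x + y) Y - infdist x Y \<le> infdist y Y"
      unfolding infdist_notempty[OF ne, of y] using ne by (intro cINF_greatest) (auto simp: algebra_simps)
    then show "infdist (x + y) Y \<le> infdist x Y + infdist y Y" by simp
  next
    fix c :: real and x assume c: "c > 0"
    have "infdist (c *\<^sub>R x) Y / c \<le> dist x a" if "a \<in> Y" for a
    proof -
      have "dist (c *\<^sub>R x) (c *\<^sub>R a) = c * dist x a"
        using c by (simp add: dist_norm flip: scaleR_diff_right)
      then show ?thesis
        using infdist_le[OF subspace_scale[OF Y that], of "c *\<^sub>R x" c] c by (simp add: divide_le_eq mult.commute)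
    qed
    then have "infdist (c *\<^sub>R x) Y / c \<le> infdist x Y"
      unfolding infdist_notempty[OF ne, of x] using ne by (intro cINF_greatest)
    then show "infdist (c *\<^sub>R x) Y \<le> c * infdist x Y"
      using c by (simp add: field_simps)
  qed (use subspace_0[OF Y] in simp)
  then obtain f where f: "linear f" "\<And>x. f x \<le> infdist x Y" "f z = infdist z Y"
    using hahn_banach_sublinear by blast
  have "f x \<le> norm x" for x
    using f(2)[of x] infdist_le[OF subspace_0[OF Y], of x] by simp
  then have "bounded_linear f"
    by (rule bounded_linear_le_norm[OF f(1)])
  moreover have "f y = 0" if "y \<in> Y" for y
    using f(2)[of y] f(2)[of "- y"] linear_neg[OF f(1), of y] that subspace_neg[OF Y that] by simp
  moreover have "f z \<noteq> 0"
    using z f(3) in_closure_iff_infdist_zero[OF ne] by simp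
  ultimately show thesis using that by blast
qed

section \<open>Isomorphic copies of \<open>c\<^sub>0\<close>\<close>

text \<open>The two estimates make \<open>G\<close> and its inverse Lipschitz. Linearity is asked
  for on \<open>S\<close> alone, because \<open>G\<close> will be a series whose convergence is
  known on \<open>c0\<close> only.\<close>

lemma linearly_homeomorphic_image:
  assumes S: "subspace S"
    and add: "\<And>x y. x \<in> S \<Longrightarrow> y \<in> S \<Longrightarrow> G (x + y) = G x + G y"
    and scale: "\<And>c x. x \<in> S \<Longrightarrow> G (c *\<^sub>R x) = c *\<^sub>R G x"
    and upper: "\<And>x. x \<in> S \<Longrightarrow> norm (G x) \<le> M * norm x"
    and lower: "\<And>x. x \<in> S \<Longrightarrow> \<delta> * norm x \<le> norm (G x)" and \<delta>: "\<delta> > 0"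
  shows "linearly_homeomorphic S (G ` S)"
proof -
  have diff: "G (x - y) = G x - G y" if "x \<in> S" "y \<in> S" for x y
    using add[of x "(-1) *\<^sub>R y"] scale[of y "-1"] subspace_scale[OF S, of y "-1"] that by simp
  have lip: "\<delta> * dist x y \<le> dist (G x) (G y)" "dist (G x) (G y) \<le> M * dist x y"
    if "x \<in> S" "y \<in> S" for x y
    using lower[OF subspace_diff[OF S that]] upper[OF subspace_diff[OF S that]] diff[OF that]
    by (simp_all add: dist_norm)
  have inj: "inj_on G S"
  proof (rule inj_onI)
    fix x y assume "x \<in> S" "y \<in> S" "G x = G y"
    then have "\<delta> * dist x y \<le> 0" using lip(1)[of x y] by simp
    then show "x = y" using \<delta> by (simp add: mult_le_0_iff)
  qed
  have "continuous_on S G"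
  proof (rule continuous_on_iff[THEN iffD2], intro ballI allI impI)
    fix x e assume "x \<in> S" "(e::real) > 0"
    have "dist (G y) (G x) < e" if "y \<in> S" "dist y x < e / (\<bar>M\<bar> + 1)" for y
    proof -
      have "M * dist y x \<le> (\<bar>M\<bar> + 1) * dist y x" by (rule mult_right_mono) auto
      also have "\<dots> < e" using that(2) by (simp add: field_simps)
      finally show ?thesis using lip(2)[OF that(1) \<open>x \<in> S\<close>] by simp
    qed
    moreover have "e / (\<bar>M\<bar> + 1) > 0" using \<open>e > 0\<close> by (simp add: divide_pos_pos)
    ultimately show "\<exists>d>0. \<forall>y\<in>S. dist y x < d \<longrightarrow> dist (G y) (G x) < e" by blast
  qed
  moreover have "continuous_on (G ` S) (inv_into S G)"
  proof (rule continuous_on_iff[THEN iffD2], intro ballI allI impI)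
    fix u e assume "u \<in> G ` S" "(e::real) > 0"
    then obtain x where x: "x \<in> S" "u = G x" by blast
    have "dist (inv_into S G v) (inv_into S G u) < e" if "v \<in> G ` S" "dist v u < \<delta> * e" for v
    proof -
      obtain y where y: "y \<in> S" "v = G y" using \<open>v \<in> G ` S\<close> by blast
      then have "\<delta> * dist y x < \<delta> * e" using lip(1)[OF y(1) x(1)] that(2) x(2) by simp
      then show ?thesis using \<delta> inj x y by (simp add: inv_into_f_f)
    qed
    moreover have "\<delta> * e > 0" using \<open>e > 0\<close> \<delta> by simp
    ultimately show "\<exists>d>0. \<forall>v\<in>G ` S. dist v u < d \<longrightarrow> dist (inv_into S G v) (inv_into S G u) < e"
      by blast
  qed
  ultimately have "homeomorphism S (G ` S) G (inv_into S G)"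
    using inj by (auto intro!: homeomorphismI simp: f_inv_into_f)
  moreover have "subspace (G ` S)"
  proof (rule subspaceI)
    show "0 \<in> G ` S" using scale[of 0 0] subspace_0[OF S] by (auto simp: image_iff)
  next
    fix u v c assume "u \<in> G ` S" "v \<in> G ` S"
    then obtain x y where xy: "x \<in> S" "y \<in> S" "u = G x" "v = G y" by blast
    show "u + v \<in> G ` S"
      by (rule image_eqI[of _ _ "x + y"]) (simp_all add: xy add subspace_add[OF S])
    show "c *\<^sub>R u \<in> G ` S"
      by (rule image_eqI[of _ _ "c *\<^sub>R x"]) (simp_all add: xy scale subspace_scale[OF S])
  qed
  ultimately show ?thesis
    unfolding linearly_homeomorphic_def using S add scale
    by (intro conjI exI[of _ G] exI[of _ "inv_into S G"]) auto
qed

text \<open>Continuity at 0 of the map and of its inverse becomes a pair of norm estimates by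
  rescaling.\<close>

lemma linearly_homeomorphic_UNIV_imp:
  fixes F :: "'y::real_normed_vector set"
  assumes "linearly_homeomorphic (UNIV :: 'x set) F"
  obtains T :: "'x::real_normed_vector \<Rightarrow> 'y" and \<delta> where "bounded_linear T" "\<delta> > 0" "\<And>x. \<delta> * norm x \<le> norm (T x)"
proof -
  obtain T :: "'x \<Rightarrow> 'y" and g where "homeomorphism UNIV F T g \<and> (\<forall>x\<in>UNIV. \<forall>y\<in>UNIV. T (x + y) = T x + T y) \<and>
      (\<forall>c. \<forall>x\<in>UNIV. T (c *\<^sub>R x) = c *\<^sub>R T x)"
    using assms unfolding linearly_homeomorphic_def by blast
  then have h: "homeomorphism UNIV F T g"
    and add: "\<And>x y. T (x + y) = T x + T y" and scale: "\<And>c x. T (c *\<^sub>R x) = c *\<^sub>R T x"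
    by auto
  have lin: "linear T" using add scale by (auto intro: linearI)
  have contT: "continuous_on UNIV T" and contg: "continuous_on F g" and gT: "\<And>x. g (T x) = x"
    and TF: "\<And>x. T x \<in> F"
    using h by (auto simp: homeomorphism_def)
  note T0 = linear_0[OF lin]
  obtain d where d: "d > 0" "\<And>x. norm x < d \<Longrightarrow> norm (T x) < 1"
    using contT[unfolded continuous_on_iff, rule_format, of 0 1] by (auto simp: T0)
  have "bounded_linear T"
  proof (rule bounded_linear_intro[where K = "2 / d"])
    fix x
    show "norm (T x) \<le> norm x * (2 / d)"
    proof (cases "x = 0")
      case False
      \<comment> \<open>The vector is rescaled to norm \<open>d / 2\<close>, which lies in the ball
        given by continuity and explains the constant \<open>2 / d\<close>.\<close>
      have "norm (T ((d / (2 * norm x)) *\<^sub>R x)) < 1"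
        by (rule d(2)) (use False d(1) in simp)
      then show ?thesis using False d(1) by (simp add: scale field_simps)
    qed (simp add: T0)
  qed (use add scale in auto)
  moreover obtain e where e: "e > 0" "\<And>u. u \<in> F \<Longrightarrow> norm u < e \<Longrightarrow> norm (g u) < 1"
    using contg[unfolded continuous_on_iff, rule_format, of "T 0" 1] TF[of 0] gT[of 0] by (auto simp: T0)
  have "e * norm x \<le> norm (T x)" for x
  proof (rule ccontr)
    assume "\<not> e * norm x \<le> norm (T x)"
    then have less: "norm (T x) < e * norm x" by simp
    then have "norm x > 0" using e(1) by (cases "x = 0") (auto simp: T0)
    then have "norm (T (inverse (norm x) *\<^sub>R x)) < e"
      using less by (simp add: scale field_simps)
    then have "norm (g (T (inverse (norm x) *\<^sub>R x))) < 1"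
      by (rule e(2)[OF TF])
    then show False using \<open>norm x > 0\<close> by (simp add: gT)
  qed
  ultimately show thesis using e(1) that by blast
qed

text \<open>
  If no block of a partition into infinite blocks works, choosing one bad row index from every
  block gives an index set on which the row sums have dropped by \<open>\<epsilon>\<close>.
\<close>

lemma rosenthal_disjointification:
  fixes a :: "nat \<Rightarrow> nat \<Rightarrow> real"
  assumes nonneg: "\<And>n k. a n k \<ge> 0" and bound: "\<And>n F. finite F \<Longrightarrow> sum (a n) F \<le> C" and "\<epsilon> > 0"
  obtains I where "infinite I" "\<And>n F. n \<in> I \<Longrightarrow> finite F \<Longrightarrow> F \<subseteq> I - {n} \<Longrightarrow> sum (a n) F \<le> \<epsilon>"
proof -
  define good where "good I \<longleftrightarrow> infinite I \<and> (\<forall>n\<in>I. \<forall>F. finite F \<and> F \<subseteq> I - {n} \<longrightarrow> sum (a n) F \<le> \<epsilon>)" for I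
  \<comment> \<open>Induction on the number of multiples of \<open>\<epsilon>\<close> that bound the
    off-diagonal row sums.\<close>
  have step: "\<exists>I\<subseteq>J. good I"
    if "infinite J" "\<forall>n\<in>J. \<forall>F. finite F \<and> F \<subseteq> J - {n} \<longrightarrow> sum (a n) F \<le> real N * \<epsilon>" for N J
    using that
  proof (induction N arbitrary: J)
    case 0
    then have "sum (a n) F \<le> \<epsilon>" if "n \<in> J" "finite F" "F \<subseteq> J - {n}" for n F
      using 0(2)[rule_format, OF that(1) conjI[OF that(2,3)]] \<open>\<epsilon> > 0\<close> by simp
    with 0(1) have "good J" unfolding good_def by blast
    then show ?case by blast
  next
    case (Suc N)
    \<comment> \<open>The pairing function splits \<open>J\<close> into infinitely many disjoint
      infinite blocks.\<close>
    define B where "B p = range (\<lambda>q. enumerate J (prod_encode (p, q)))" for p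
    have inj: "enumerate J i = enumerate J j \<longleftrightarrow> i = j" for i j
      using inj_enumerate[OF Suc.prems(1)] by (simp add: inj_eq)
    have BJ: "B p \<subseteq> J" for p
      using enumerate_in_set[OF Suc.prems(1)] by (auto simp: B_def)
    have Binf: "infinite (B p)" for p
      unfolding B_def by (rule range_inj_infinite) (simp add: inj_def inj)
    have Bdisj: "p = p'" if "i \<in> B p" "i \<in> B p'" for i p p'
      using that by (auto simp: B_def inj)
    show ?case
    proof (cases "\<exists>p. \<forall>n\<in>B p. \<forall>F. finite F \<and> F \<subseteq> B p - {n} \<longrightarrow> sum (a n) F \<le> \<epsilon>")
      case True
      then obtain p where "\<forall>n\<in>B p. \<forall>F. finite F \<and> F \<subseteq> B p - {n} \<longrightarrow> sum (a n) F \<le> \<epsilon>" ..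
      with Binf[of p] have "good (B p)" unfolding good_def by (rule conjI)
      with BJ show ?thesis by blast
    next
      case False
      then have "\<forall>p. \<exists>n F. n \<in> B p \<and> finite F \<and> F \<subseteq> B p - {n} \<and> sum (a n) F > \<epsilon>"
        by (simp only: not_ex not_all not_le not_imp bex_simps ball_simps Bex_def Ball_def) blast
      then obtain n F where nF: "\<And>p. n p \<in> B p" "\<And>p. finite (F p)" "\<And>p. F p \<subseteq> B p - {n p}"
        "\<And>p. sum (a (n p)) (F p) > \<epsilon>"
        by metis
      have "inj n" by (rule injI) (metis Bdisj nF(1))
      have "sum (a (n p)) H \<le> real N * \<epsilon>" if "finite H" "H \<subseteq> range n - {n p}" for p H
      proof -
        \<comment> \<open>\<open>H\<close> has at most one index in each block, and the one in block
          \<open>p\<close> is excluded. So \<open>H\<close> is disjoint from \<open>F p\<close>,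
          whose sum exceeds \<open>\<epsilon>\<close>.\<close>
        have "False" if h: "h \<in> H" "h \<in> F p" for h
        proof -
          obtain p' where "h = n p'" "h \<noteq> n p" using h(1) \<open>H \<subseteq> range n - {n p}\<close> by blast
          moreover have "h \<in> B p" using h(2) nF(3) by blast
          ultimately show False using nF(1)[of p'] Bdisj by metis
        qed
        then have "H \<inter> F p = {}" by blast
        then have "sum (a (n p)) H + sum (a (n p)) (F p) = sum (a (n p)) (H \<union> F p)"
          using that(1) nF(2) by (simp add: sum.union_disjoint)
        also have "\<dots> \<le> real (Suc N) * \<epsilon>"
        proof -
          have "H \<union> F p \<subseteq> J - {n p}"
            using that(2) nF(3)[of p] nF(1) BJ by fast
          then show ?thesis
            using Suc.prems(2) nF(1)[of p] BJ[of p] that(1) nF(2)[of p] by blast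
        qed
        finally show ?thesis using nF(4)[of p] by (simp add: algebra_simps)
      qed
      then have "\<exists>I\<subseteq>range n. good I"
        using range_inj_infinite[OF \<open>inj n\<close>] by (intro Suc.IH) auto
      moreover have "range n \<subseteq> J" using nF(1) BJ by blast
      ultimately show ?thesis by blast
    qed
  qed
  obtain N :: nat where "C / \<epsilon> \<le> real N" using real_arch_simple by blast
  then have "C \<le> real N * \<epsilon>" using \<open>\<epsilon> > 0\<close> by (simp add: field_simps)
  then have "\<forall>n\<in>UNIV. \<forall>F. finite F \<and> F \<subseteq> UNIV - {n} \<longrightarrow> sum (a n) F \<le> real N * \<epsilon>"
    using bound order_trans by blast
  from step[OF infinite_UNIV_nat this] obtain I where "good I" by blast
  then have I: "infinite I" "\<forall>n\<in>I. \<forall>F. finite F \<and> F \<subseteq> I - {n} \<longrightarrow> sum (a n) F \<le> \<epsilon>"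
    unfolding good_def by (rule conjunct1, rule conjunct2)
  show thesis
    by (rule that[OF I(1)]) (rule I(2)[rule_format], assumption, rule conjI)
qed

section \<open>Building copies of \<open>c0\<close>\<close>

lemma subspace_c0: "subspace c0"
proof (rule subspaceI)
  fix x y :: "nat \<Rightarrow>\<^sub>C real" and c :: real
  assume "x \<in> c0"
  then show "c *\<^sub>R x \<in> c0"
    using tendsto_mult_right_zero[of "apply_bcontfun x" sequentially c] by (simp add: c0_def scaleR_bcontfun.rep_eq)
  assume "y \<in> c0"
  with \<open>x \<in> c0\<close> show "x + y \<in> c0"
    using tendsto_add_zero[of "apply_bcontfun x" sequentially "apply_bcontfun y"] by (simp add: c0_def plus_bcontfun.rep_eq)
qed (simp add: c0_def)

text \<open>A sequence \<open>x\<close> is mapped to the sum of its coordinates times the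
  \<open>v j\<close>. The bound \<open>M\<close> gives convergence and continuity;
  \<open>e n\<close> recovers coordinate \<open>n\<close> up to an error of
  \<open>\<delta> / 2 * norm x\<close>, which gives the lower estimate.\<close>

lemma c0_embedding_of_biorthogonal:
  fixes v :: "nat \<Rightarrow> 'e::banach"
  assumes M: "\<And>F c b. finite F \<Longrightarrow> b \<ge> 0 \<Longrightarrow> (\<And>j. j \<in> F \<Longrightarrow> \<bar>c j\<bar> \<le> b) \<Longrightarrow> norm (\<Sum>j\<in>F. c j *\<^sub>R v j) \<le> M * b"
    and \<delta>: "\<delta> > 0" "\<And>j. norm (v j) \<ge> \<delta>"
    and e: "\<And>n. bounded_linear (e n)" "\<And>n x. \<bar>e n x\<bar> \<le> norm x" "\<And>n. e n (v n) = norm (v n)"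
    and off: "\<And>n F. finite F \<Longrightarrow> n \<notin> F \<Longrightarrow> (\<Sum>k\<in>F. \<bar>e n (v k)\<bar>) \<le> \<delta> / 2"
  shows "\<exists>F::'e set. linearly_homeomorphic c0 F"
proof -
  define G where "G x = (\<Sum>j. apply_bcontfun x j *\<^sub>R v j)" for x :: "nat \<Rightarrow>\<^sub>C real"
  have "M \<ge> 0" using M[of "{}" 1] by simp
  have le: "\<bar>apply_bcontfun x j\<bar> \<le> norm x" for x :: "nat \<Rightarrow>\<^sub>C real" and j
    using norm_bounded[of x j] by simp
  have summ: "summable (\<lambda>j. apply_bcontfun x j *\<^sub>R v j)" if "x \<in> c0" for x
  proof (subst summable_Cauchy, intro allI impI)
    fix \<eta> :: real assume "\<eta> > 0"
    \<comment> \<open>Dividing by \<open>M + 1\<close> instead of \<open>M\<close> also covers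
      \<open>M = 0\<close>.\<close>
    define \<rho> where "\<rho> = \<eta> / (M + 1)"
    have \<rho>: "\<rho> > 0" "M * \<rho> < \<eta>"
      using \<open>\<eta> > 0\<close> \<open>M \<ge> 0\<close> by (auto simp: \<rho>_def field_simps)
    have "apply_bcontfun x \<longlonglongrightarrow> 0" using that by (simp add: c0_def)
    then obtain N where N: "\<And>j. j \<ge> N \<Longrightarrow> \<bar>apply_bcontfun x j\<bar> < \<rho>"
      using \<rho>(1) by (auto simp: lim_sequentially dist_real_def)
    have "norm (\<Sum>j=m..<n. apply_bcontfun x j *\<^sub>R v j) < \<eta>" if "m \<ge> N" for m n
      using M[of "{m..<n}" \<rho> "apply_bcontfun x"] \<rho> N that by (fastforce intro: less_imp_le)
    then show "\<exists>N. \<forall>m\<ge>N. \<forall>n. norm (\<Sum>j=m..<n. apply_bcontfun x j *\<^sub>R v j) < \<eta>" by blast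
  qed
  have lim: "(\<lambda>N. norm (\<Sum>j<N. apply_bcontfun x j *\<^sub>R v j)) \<longlonglongrightarrow> norm (G x)" if "x \<in> c0" for x
    unfolding G_def by (intro tendsto_norm summable_LIMSEQ summ that)
  have upper: "norm (G x) \<le> M * norm x" if "x \<in> c0" for x
    by (rule LIMSEQ_le_const2[OF lim[OF that]]) (auto intro!: M le)
  have coord: "\<delta> * \<bar>apply_bcontfun x n\<bar> - \<delta> / 2 * norm x \<le> norm (G x)" if "x \<in> c0" for x n
  proof (rule LIMSEQ_le_const[OF lim[OF that]], intro exI allI impI)
    fix N assume "Suc n \<le> N"
    then have N: "n \<in> {..<N}" by auto
    let ?r = "\<Sum>j\<in>{..<N}-{n}. apply_bcontfun x j * e n (v j)"
    interpret bounded_linear "e n" by (rule e(1))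
    have eq: "e n (\<Sum>j<N. apply_bcontfun x j *\<^sub>R v j) = apply_bcontfun x n * norm (v n) + ?r"
      by (simp add: sum add scale sum.remove[OF _ N] e(3))
    have "\<bar>?r\<bar> \<le> (\<Sum>j\<in>{..<N}-{n}. \<bar>e n (v j)\<bar> * norm x)"
      by (rule order_trans[OF sum_abs sum_mono]) (simp add: abs_mult mult.commute[of "\<bar>e n _\<bar>"] mult_right_mono le)
    also have "\<dots> \<le> \<delta> / 2 * norm x"
      using mult_right_mono[OF off[of "{..<N}-{n}" n] norm_ge_zero[of x]]
      by (simp only: sum_distrib_right) simp
    finally have r: "\<bar>?r\<bar> \<le> \<delta> / 2 * norm x" .
    have "\<delta> * \<bar>apply_bcontfun x n\<bar> \<le> \<bar>apply_bcontfun x n * norm (v n)\<bar>"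
      using mult_right_mono[OF \<delta>(2)[of n] abs_ge_zero[of "apply_bcontfun x n"]]
      by (simp add: abs_mult mult.commute)
    with r eq have "\<delta> * \<bar>apply_bcontfun x n\<bar> - \<delta> / 2 * norm x \<le> \<bar>e n (\<Sum>j<N. apply_bcontfun x j *\<^sub>R v j)\<bar>"
      by linarith
    also have "\<dots> \<le> norm (\<Sum>j<N. apply_bcontfun x j *\<^sub>R v j)" by (rule e(2))
    finally show "\<delta> * \<bar>apply_bcontfun x n\<bar> - \<delta> / 2 * norm x \<le> norm (\<Sum>j<N. apply_bcontfun x j *\<^sub>R v j)" .
  qed
  have lower: "\<delta> / 2 * norm x \<le> norm (G x)" if "x \<in> c0" for x
  proof -
    \<comment> \<open>Taking the supremum over \<open>n\<close> turns the coordinate estimates into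
      one for \<open>norm x\<close>, and the error term is absorbed.\<close>
    have "norm (apply_bcontfun x n) \<le> (norm (G x) + \<delta> / 2 * norm x) / \<delta>" for n
      using coord[OF that, of n] \<delta>(1) by (simp add: field_simps)
    then have "norm x \<le> (norm (G x) + \<delta> / 2 * norm x) / \<delta>" by (rule norm_bound)
    then show ?thesis using \<delta>(1) by (simp add: field_simps)
  qed
  have "linearly_homeomorphic c0 (G ` c0)"
  proof (rule linearly_homeomorphic_image[OF subspace_c0 _ _ upper lower])
    show "G (x + y) = G x + G y" if "x \<in> c0" "y \<in> c0" for x y
      unfolding G_def by (simp add: plus_bcontfun.rep_eq scaleR_left_distrib suminf_add summ that)
    show "G (c *\<^sub>R x) = c *\<^sub>R G x" if "x \<in> c0" for c x
      unfolding G_def using suminf_scaleR_right[OF summ[OF that], of c] by (simp add: scaleR_bcontfun.rep_eq)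
  qed (use \<delta> in auto)
  then show ?thesis by blast
qed

text \<open>A form of the Bessaga-Pelczynski theorem: the bound says that the series of the
  \<open>v j\<close> is weakly unconditionally Cauchy. If its terms stayed away from 0 along a
  subsequence, norming functionals and Rosenthal's lemma would produce a copy of
  \<open>c0\<close>.\<close>

lemma tendsto_0_if_no_c0:
  fixes v :: "nat \<Rightarrow> 'e::banach"
  assumes no_c0: "\<nexists>F::'e set. linearly_homeomorphic c0 F"
    and M: "\<And>F c b. finite F \<Longrightarrow> b \<ge> 0 \<Longrightarrow> (\<And>j. j \<in> F \<Longrightarrow> \<bar>c j\<bar> \<le> b) \<Longrightarrow> norm (\<Sum>j\<in>F. c j *\<^sub>R v j) \<le> M * b"
  shows "v \<longlonglongrightarrow> 0"
proof (rule ccontr)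
  assume "\<not> v \<longlonglongrightarrow> 0"
  then obtain \<delta> where \<delta>: "\<delta> > 0" and "\<forall>N. \<exists>j\<ge>N. norm (v j) \<ge> \<delta>"
    by (auto simp: lim_sequentially not_less)
  then have inf: "infinite {j. norm (v j) \<ge> \<delta>}"
    by (auto simp: infinite_nat_iff_unbounded_le)
  have reindex: "norm (\<Sum>j\<in>F. c j *\<^sub>R v (s j)) \<le> M * b"
    if "inj s" "finite F" "b \<ge> 0" "\<And>j. j \<in> F \<Longrightarrow> \<bar>c j\<bar> \<le> b" for s F c b
  proof -
    have "(\<Sum>j\<in>F. c j *\<^sub>R v (s j)) = (\<Sum>k\<in>s ` F. c (inv s k) *\<^sub>R v k)"
      using that(1) by (simp add: sum.reindex inj_on_subset[OF that(1)])
    moreover have "norm (\<Sum>k\<in>s ` F. c (inv s k) *\<^sub>R v k) \<le> M * b"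
      by (rule M) (use that in auto)
    ultimately show ?thesis by simp
  qed
  define s where "s = enumerate {j. norm (v j) \<ge> \<delta>}"
  have s: "inj s" "\<And>j. norm (v (s j)) \<ge> \<delta>"
    using inj_enumerate[OF inf] enumerate_in_set[OF inf] by (auto simp: s_def)
  have "\<exists>f. bounded_linear f \<and> (\<forall>x. \<bar>f x\<bar> \<le> norm x) \<and> f (v (s n)) = norm (v (s n))" for n
    by (metis norming_functional)
  then obtain e where e: "\<And>n. bounded_linear (e n)" "\<And>n x. \<bar>e n x\<bar> \<le> norm x"
    "\<And>n. e n (v (s n)) = norm (v (s n))"
    by metis
  have "(\<Sum>k\<in>F. \<bar>e n (v (s k))\<bar>) \<le> M" if "finite F" for n F
  proof -
    interpret bounded_linear "e n" by (rule e(1))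
    \<comment> \<open>Signs as coefficients turn the sum of absolute values into a single value of
      \<open>e n\<close>, at a vector of norm at most \<open>M\<close>.\<close>
    have "(\<Sum>k\<in>F. \<bar>e n (v (s k))\<bar>) = e n (\<Sum>k\<in>F. sgn (e n (v (s k))) *\<^sub>R v (s k))"
      by (simp add: sum scale abs_sgn mult.commute)
    also have "\<dots> \<le> norm (\<Sum>k\<in>F. sgn (e n (v (s k))) *\<^sub>R v (s k))"
      using e(2) abs_le_D1 by blast
    also have "\<dots> \<le> M * 1"
      by (rule reindex[OF s(1) that]) (auto simp: abs_sgn_eq)
    finally show ?thesis by simp
  qed
  then obtain I where I: "infinite I"
    "\<And>n F. n \<in> I \<Longrightarrow> finite F \<Longrightarrow> F \<subseteq> I - {n} \<Longrightarrow> (\<Sum>k\<in>F. \<bar>e n (v (s k))\<bar>) \<le> \<delta> / 2"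
    using rosenthal_disjointification[of "\<lambda>n k. \<bar>e n (v (s k))\<bar>" M "\<delta> / 2"] \<delta> by auto
  define t where "t = enumerate I"
  have t: "inj t" "\<And>j. t j \<in> I"
    using inj_enumerate[OF I(1)] enumerate_in_set[OF I(1)] by (auto simp: t_def)
  have "\<exists>F::'e set. linearly_homeomorphic c0 F"
  proof (rule c0_embedding_of_biorthogonal[where v = "\<lambda>j. v (s (t j))" and e = "\<lambda>n. e (t n)", OF _ \<delta>])
    show "norm (\<Sum>j\<in>F. c j *\<^sub>R v (s (t j))) \<le> M * b"
      if "finite F" "b \<ge> 0" "\<And>j. j \<in> F \<Longrightarrow> \<bar>c j\<bar> \<le> b" for F c b
      using reindex[of "s \<circ> t" F b c] s(1) t(1) that by (simp add: inj_compose)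
    show "(\<Sum>k\<in>F. \<bar>e (t n) (v (s (t k)))\<bar>) \<le> \<delta> / 2" if "finite F" "n \<notin> F" for n F
    proof -
      have "t ` F \<subseteq> I - {t n}" using t that by (auto simp: inj_eq)
      then have "(\<Sum>k\<in>t ` F. \<bar>e (t n) (v (s k))\<bar>) \<le> \<delta> / 2"
        using I(2)[OF t(2)] that(1) by blast
      then show ?thesis by (simp add: sum.reindex inj_on_subset[OF t(1)])
    qed
  qed (use s(2) e in auto)
  with no_c0 show False by blast
qed

section \<open>Scattered compact spaces\<close>

definition clopen :: "'a::topological_space set \<Rightarrow> bool" where
  "clopen V \<longleftrightarrow> open V \<and> closed V"

lemma clopen_Int: "clopen U \<Longrightarrow> clopen V \<Longrightarrow> clopen (U \<inter> V)"
  and clopen_Un: "clopen U \<Longrightarrow> clopen V \<Longrightarrow> clopen (U \<union> V)"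
  and clopen_Diff: "clopen U \<Longrightarrow> clopen V \<Longrightarrow> clopen (U - V)"
  and clopen_Compl: "clopen U \<Longrightarrow> clopen (- U)"
  and clopen_empty: "clopen {}"
  and clopen_UNIV: "clopen UNIV"
  by (auto simp: clopen_def)

section \<open>Cantor-Bendixson derivatives\<close>

lemma accumulation_points_mono: "A \<subseteq> B \<Longrightarrow> accumulation_points A \<subseteq> accumulation_points B"
  by (auto simp: accumulation_points_def intro: islimpt_subset)

lemma closed_accumulation_points:
  assumes "closed X"
  shows "closed (accumulation_points X)"
proof -
  have "\<exists>T. open T \<and> x \<in> T \<and> T \<subseteq> - accumulation_points X"
    if x: "x \<notin> accumulation_points X" for x
  proof (cases "x \<in> X")
    case False
    then show ?thesis
      using assms by (intro exI[of _ "- X"]) (auto simp: accumulation_points_def)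
  next
    case True
    then obtain T where T: "open T" "x \<in> T" "\<forall>y\<in>X. y \<in> T \<longrightarrow> y = x"
      using x by (auto simp: accumulation_points_def islimpt_def)
    have "accumulation_points X \<subseteq> X" by (auto simp: accumulation_points_def)
    with T x show ?thesis by blast
  qed
  from this[OF ComplD] have "open (- accumulation_points X)"
    by (rule Topological_Spaces.openI)
  then show ?thesis by (simp add: closed_def)
qed

lemma closed_cb_deriv:
  assumes "closed X"
  shows "closed (cb_deriv X 0 n)"
  by (induction n) (simp_all add: assms closed_accumulation_points)

lemma cb_deriv_antimono:
  assumes "m \<le> n"
  shows "cb_deriv X 0 n \<subseteq> cb_deriv X 0 m"
proof -
  have "cb_deriv X 0 (Suc k) \<subseteq> cb_deriv X 0 k" for k
    by (simp add: accumulation_points_def)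
  then show ?thesis
    by (rule lift_Suc_antimono_le[OF _ assms])
qed

lemma finite_cb_deriv_Suc:
  fixes X :: "'a::t1_space set"
  assumes "finite (cb_deriv X 0 n)"
  shows "cb_deriv X 0 (Suc n) = {}"
  using assms by (auto simp: accumulation_points_def islimpt_finite)

text \<open>The inclusion says that \<open>A\<close> is dense in itself. This form speaks about
  arbitrary subsets and needs no transfinite derivatives.\<close>

definition scattered :: "'a::topological_space set \<Rightarrow> bool" where
  "scattered X \<longleftrightarrow> (\<forall>A\<subseteq>X. A \<subseteq> accumulation_points A \<longrightarrow> A = {})"

lemma scattered_isolated_point:
  assumes "scattered X" "A \<subseteq> X" "A \<noteq> {}"
  obtains x T where "x \<in> A" "open T" "T \<inter> A = {x}"
proof -
  obtain x where x: "x \<in> A" "\<not> x islimpt A"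
    using assms by (auto simp: scattered_def accumulation_points_def)
  then obtain T where "open T" "x \<in> T" "\<forall>y\<in>A. y \<in> T \<longrightarrow> y = x"
    by (auto simp: islimpt_def)
  with x(1) have "T \<inter> A = {x}" by blast
  with x(1) \<open>open T\<close> show thesis by (rule that)
qed

text \<open>A subset that is dense in itself survives every derivative, including the empty one of
  order \<open>\<omega> + 1\<close>.\<close>

lemma has_height_scattered:
  assumes "has_height X 1 1"
  shows "scattered X"
  unfolding scattered_def
proof (intro allI impI)
  fix A assume A: "A \<subseteq> X" "A \<subseteq> accumulation_points A"
  have "A \<subseteq> cb_deriv X 0 n" for n
  proof (induction n)
    case (Suc n)
    then show ?case using A(2) accumulation_points_mono[OF Suc] by simp
  qed (simp add: A)
  then have "A \<subseteq> cb_deriv X 1 0" by auto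
  then have "A \<subseteq> cb_deriv X 1 1"
    using A(2) accumulation_points_mono[of A "cb_deriv X 1 0"] by simp
  with assms show "A = {}" by (auto simp: has_height_def)
qed

text \<open>A set without its accumulation points is discrete, and height
  \<open>\<omega> + 1\<close> leaves only countably many such layers. Cardinalities can then be
  bounded layer by layer.\<close>

lemma has_height_discrete_levels:
  assumes "has_height X 1 1"
  obtains D :: "nat \<Rightarrow> 'a::topological_space set"
  where "X \<subseteq> (\<Union>n. D n)" "\<And>n x. x \<in> D n \<Longrightarrow> \<exists>T. open T \<and> T \<inter> D n = {x}"
proof -
  \<comment> \<open>\<open>D 0\<close> is the derivative of order \<open>\<omega>\<close>, discrete
    because the next one is empty; \<open>D (Suc n)\<close> holds the points of rank exactly
    \<open>n\<close>.\<close>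
  define D where "D n = (case n of 0 \<Rightarrow> cb_deriv X 1 0 | Suc n \<Rightarrow> cb_deriv X 0 n - cb_deriv X 0 (Suc n))" for n
  have discrete: "\<exists>T. open T \<and> T \<inter> (A - accumulation_points A) = {x}"
    if x: "x \<in> A - accumulation_points A" for x and A :: "'a set"
  proof -
    obtain T where "open T" "x \<in> T" "\<forall>y\<in>A. y \<in> T \<longrightarrow> y = x"
      using x by (auto simp: islimpt_def accumulation_points_def)
    with x show ?thesis by (intro exI[of _ T]) auto
  qed
  show thesis
  proof (rule that)
    show "X \<subseteq> (\<Union>n. D n)"
    proof
      fix x assume x: "x \<in> X"
      show "x \<in> (\<Union>n. D n)"
      proof (rule ccontr)
        assume *: "x \<notin> (\<Union>n. D n)"
        have "x \<in> cb_deriv X 0 n" for n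
        proof (induction n)
          case (Suc n)
          moreover have "x \<notin> D (Suc n)" using * by blast
          ultimately show ?case by (simp add: D_def)
        qed (simp add: x)
        then have "x \<in> D 0" by (simp add: D_def)
        with * show False by blast
      qed
    qed
    show "\<exists>T. open T \<and> T \<inter> D n = {x}" if "x \<in> D n" for n x
    proof (cases n)
      case 0
      have "accumulation_points (cb_deriv X 1 0) = {}"
        using assms by (simp add: has_height_def)
      then show ?thesis using discrete[of x "cb_deriv X 1 0"] that by (simp add: D_def 0)
    next
      case (Suc k)
      then show ?thesis using discrete[of x "cb_deriv X 0 k"] that by (simp add: D_def)
    qed
  qed
qed

section \<open>Clopen sets in compact scattered spaces\<close>

lemma compact_regular:
  fixes x :: "'a::t2_space"
  assumes K: "compact (UNIV :: 'a set)" and U: "open U" "x \<in> U"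
  obtains V where "open V" "x \<in> V" "closure V \<subseteq> U"
proof -
  have "\<forall>y\<in>- U. \<exists>V W. open V \<and> open W \<and> x \<in> V \<and> y \<in> W \<and> V \<inter> W = {}"
    using U(2) by (metis ComplD hausdorff)
  then obtain V W where VW: "\<And>y. y \<in> - U \<Longrightarrow> open (V y) \<and> open (W y) \<and> x \<in> V y \<and> y \<in> W y \<and> V y \<inter> W y = {}"
    by metis
  have "compact (- U)" using compact_Int_closed[OF K, of "- U"] U(1) by (simp add: closed_Compl)
  then obtain C where C: "C \<subseteq> - U" "finite C" "- U \<subseteq> (\<Union>y\<in>C. W y)"
    by (rule compactE_image[of "- U" "- U" W]) (use VW in auto)
  show thesis
  proof (rule that)
    show "open (\<Inter>y\<in>C. V y)" "x \<in> (\<Inter>y\<in>C. V y)" using C VW by auto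
    have "closure (\<Inter>y\<in>C. V y) \<subseteq> - (\<Union>y\<in>C. W y)"
    proof (rule closure_minimal)
      show "closed (- (\<Union>y\<in>C. W y))" using C(1) VW by (intro closed_Compl open_UN) blast
      have "V y \<inter> W y = {}" if "y \<in> C" for y using C(1) VW that by blast
      then show "(\<Inter>y\<in>C. V y) \<subseteq> - (\<Union>y\<in>C. W y)" by blast
    qed
    then show "closure (\<Inter>y\<in>C. V y) \<subseteq> U" using C(3) by blast
  qed
qed

text \<open>Consider the points where a clopen base is missing. An isolated point \<open>z\<close>
  of this set has a neighbourhood whose boundary avoids the set; finitely many clopen sets missing
  \<open>z\<close> cover that boundary and can be cut away.\<close>

lemma scattered_compact_clopen_base:
  fixes x :: "'a::t2_space"
  assumes K: "compact (UNIV :: 'a set)" and sc: "scattered (UNIV :: 'a set)" and U: "open U" "x \<in> U"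
  obtains V where "clopen V" "x \<in> V" "V \<subseteq> U"
proof -
  define A where "A = {x::'a. \<exists>U. open U \<and> x \<in> U \<and> (\<forall>V. clopen V \<and> x \<in> V \<longrightarrow> \<not> V \<subseteq> U)}"
  have "A = {}"
  proof (rule ccontr)
    assume "A \<noteq> {}"
    then obtain z T where z: "z \<in> A" and T: "open T" "T \<inter> A = {z}"
      using scattered_isolated_point[OF sc subset_UNIV] by metis
    obtain U where U: "open U" "z \<in> U" and noV: "\<And>V. clopen V \<Longrightarrow> z \<in> V \<Longrightarrow> \<not> V \<subseteq> U"
      using z by (auto simp: A_def)
    have UT: "open (U \<inter> T)" "z \<in> U \<inter> T" using U T by auto
    obtain V where V: "open V" "z \<in> V" "closure V \<subseteq> U \<inter> T"
      by (rule compact_regular[OF K UT])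
    have "\<exists>C. clopen C \<and> y \<in> C \<and> C \<subseteq> - {z}" if "y \<in> closure V - V" for y
    proof -
      have "y \<noteq> z" "y \<notin> A" using that V T(2) by auto
      then have "\<exists>C. clopen C \<and> y \<in> C \<and> C \<subseteq> B" if "open B" "y \<in> B" for B
        using that by (auto simp: A_def)
      from this[of "- {z}"] show ?thesis using \<open>y \<noteq> z\<close> by auto
    qed
    then obtain C where C: "\<And>y. y \<in> closure V - V \<Longrightarrow> clopen (C y) \<and> y \<in> C y \<and> C y \<subseteq> - {z}"
      by metis
    have "compact (closure V - V)"
      using compact_Int_closed[OF K, of "closure V - V"] V(1) by (simp add: closed_Diff)
    then obtain Y where Y: "Y \<subseteq> closure V - V" "finite Y" "closure V - V \<subseteq> (\<Union>y\<in>Y. C y)"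
      by (rule compactE_image[of "closure V - V" "closure V - V" C]) (use C in \<open>auto simp: clopen_def\<close>)
    \<comment> \<open>With the boundary covered, \<open>V\<close> and its closure leave the same
      remainder, which is therefore both open and closed.\<close>
    define W where "W = V - (\<Union>y\<in>Y. C y)"
    have eq: "W = closure V - (\<Union>y\<in>Y. C y)"
      using Y(3) closure_subset[of V] by (auto simp: W_def)
    have "open W"
      unfolding W_def using Y C V(1) by (intro open_Diff closed_UN) (auto simp: clopen_def)
    moreover have "closed W"
      unfolding eq using Y C by (intro closed_Diff closed_closure open_UN) (auto simp: clopen_def)
    moreover have "z \<in> W" using V(2) Y(1) C by (fastforce simp: W_def)
    moreover have "W \<subseteq> U" using V(3) by (auto simp: eq)
    ultimately show False using noV by (simp add: clopen_def)
  qed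
  then have "x \<notin> A" by simp
  with U show thesis using that unfolding A_def by blast
qed

text \<open>Two points of \<open>P\<close> in the current set are separated by a clopen set. A half
  with infinitely many points of \<open>P\<close> is kept; the discarded halves still meet
  \<open>P\<close> and form the sequence.\<close>

lemma disjoint_clopen_sequence:
  fixes P R :: "'a::t2_space set"
  assumes K: "compact (UNIV :: 'a set)" and sc: "scattered (UNIV :: 'a set)"
    and R: "clopen R" "infinite (P \<inter> R)"
  obtains V :: "nat \<Rightarrow> 'a set" where "\<And>n. clopen (V n)" "\<And>n. V n \<subseteq> R" "\<And>n. P \<inter> V n \<noteq> {}" "disjoint_family V"
proof -
  have step: "\<exists>R'. (clopen R' \<and> infinite (P \<inter> R')) \<and> R' \<subseteq> R \<and> P \<inter> (R - R') \<noteq> {}"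
    if R: "clopen R \<and> infinite (P \<inter> R)" for R
  proof -
    obtain a where a: "a \<in> P \<inter> R"
      using R infinite_imp_nonempty by blast
    obtain b where b: "b \<in> P \<inter> R" "b \<noteq> a"
      using infinite_imp_nonempty[OF infinite_remove[of "P \<inter> R" a]] R by blast
    obtain V where V: "clopen V" "a \<in> V" "V \<subseteq> - {b}"
      by (rule scattered_compact_clopen_base[OF K sc, of "- {b}" a]) (use b in auto)
    have "P \<inter> R = (P \<inter> (R \<inter> V)) \<union> (P \<inter> (R - V))" by auto
    then have "infinite (P \<inter> (R \<inter> V)) \<or> infinite (P \<inter> (R - V))"
      using R by (metis finite_Un)
    then show ?thesis
    proof
      assume "infinite (P \<inter> (R \<inter> V))"
      then show ?thesis using R V b by (intro exI[of _ "R \<inter> V"]) (auto simp: clopen_Int)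
    next
      assume "infinite (P \<inter> (R - V))"
      then show ?thesis using R V a by (intro exI[of _ "R - V"]) (auto simp: clopen_Diff)
    qed
  qed
  obtain f :: "nat \<Rightarrow> 'a set" where f0: "f 0 = R" and f: "\<And>n. clopen (f n) \<and> infinite (P \<inter> f n)"
    "\<And>n. f (Suc n) \<subseteq> f n \<and> P \<inter> (f n - f (Suc n)) \<noteq> {}"
  proof -
    have "\<exists>f. f 0 = R \<and> (\<forall>n. clopen (f n) \<and> infinite (P \<inter> f n)) \<and>
        (\<forall>n. f (Suc n) \<subseteq> f n \<and> P \<inter> (f n - f (Suc n)) \<noteq> {})"
    proof -
      define g where "g = rec_nat R (\<lambda>_ Q. SOME R'. (clopen R' \<and> infinite (P \<inter> R')) \<and> R' \<subseteq> Q \<and> P \<inter> (Q - R') \<noteq> {})"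
      have gS: "(clopen (g (Suc n)) \<and> infinite (P \<inter> g (Suc n))) \<and> g (Suc n) \<subseteq> g n \<and> P \<inter> (g n - g (Suc n)) \<noteq> {}"
        if "clopen (g n) \<and> infinite (P \<inter> g n)" for n
        using someI_ex[OF step[OF that]] by (simp add: g_def)
      have inv: "clopen (g n) \<and> infinite (P \<inter> g n)" for n
        by (induction n) (use R gS in \<open>auto simp: g_def\<close>)
      show ?thesis
        by (rule exI[of _ g]) (use inv gS[OF inv] in \<open>auto simp: g_def\<close>)
    qed
    then show thesis using that by blast
  qed
  have mono: "f n \<subseteq> f m" if "m \<le> n" for m n
    using that by (rule lift_Suc_antimono_le[of f, rotated]) (use f in blast)
  show thesis
  proof (rule that[of "\<lambda>n. f n - f (Suc n)"])
    show "disjoint_family (\<lambda>n. f n - f (Suc n))"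
      unfolding disjoint_family_on_def
    proof (intro ballI impI)
      fix m n :: nat assume "m \<noteq> n"
      then show "(f m - f (Suc m)) \<inter> (f n - f (Suc n)) = {}"
        using mono[of "Suc m" n] mono[of "Suc n" m] by (cases "m < n") auto
    qed
    show "f n - f (Suc n) \<subseteq> R" for n using mono[of 0 n] f0 by auto
    show "clopen (f n - f (Suc n))" for n using f(1)[of n] f(1)[of "Suc n"] clopen_Diff by blast
    show "P \<inter> (f n - f (Suc n)) \<noteq> {}" for n using f(2)[of n] by blast
  qed
qed

text \<open>
  The set \<open>S\<close> consists of the atoms of \<open>m\<close>; those of size more than \<open>\<epsilon>\<close> are collected in
  \<open>bad \<epsilon>\<close>, which is finite because \<open>m\<close> is exhaustive.
\<close>

lemma exhaustive_countable_support:
  fixes m :: "'a::t2_space set \<Rightarrow> 'b::real_normed_vector"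
  assumes K: "compact (UNIV :: 'a set)" and sc: "scattered (UNIV :: 'a set)"
    and add: "\<And>A B. clopen A \<Longrightarrow> clopen B \<Longrightarrow> A \<inter> B = {} \<Longrightarrow> m (A \<union> B) = m A + m B"
    and exh: "\<And>V::nat \<Rightarrow> 'a set. (\<And>n. clopen (V n)) \<Longrightarrow> disjoint_family V \<Longrightarrow> (\<lambda>n. m (V n)) \<longlonglongrightarrow> 0"
  obtains S where "countable S" "\<And>U. clopen U \<Longrightarrow> U \<inter> S = {} \<Longrightarrow> m U = 0"
proof -
  define bad where "bad \<epsilon> = {x. \<forall>V. clopen V \<and> x \<in> V \<longrightarrow> (\<exists>W. clopen W \<and> x \<in> W \<and> W \<subseteq> V \<and> norm (m W) > \<epsilon>)}" for \<epsilon>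
  have fin: "finite (bad \<epsilon>)" if "\<epsilon> > 0" for \<epsilon>
  proof (rule ccontr)
    assume "infinite (bad \<epsilon>)"
    then have "infinite (bad \<epsilon> \<inter> UNIV)" by simp
    then obtain V :: "nat \<Rightarrow> 'a set" where V: "\<And>n. clopen (V n)" "\<And>n. bad \<epsilon> \<inter> V n \<noteq> {}" "disjoint_family V"
      using disjoint_clopen_sequence[OF K sc clopen_UNIV, of "bad \<epsilon>"] by metis
    have "\<exists>W. clopen W \<and> W \<subseteq> V n \<and> norm (m W) > \<epsilon>" for n
      using V(1,2)[of n] by (auto simp: bad_def)
    then obtain W where W: "\<And>n. clopen (W n)" "\<And>n. W n \<subseteq> V n" "\<And>n. norm (m (W n)) > \<epsilon>"
      by metis
    have "disjoint_family W" using V(3) W(2) by (rule disjoint_family_subset)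
    then have "(\<lambda>n. m (W n)) \<longlonglongrightarrow> 0" by (intro exh W(1))
    then have "\<exists>N. \<forall>n\<ge>N. norm (m (W n)) < \<epsilon>" using that by (simp add: lim_sequentially)
    then obtain n where "norm (m (W n)) < \<epsilon>" by blast
    with W(3)[of n] show False by simp
  qed
  show thesis
  proof (rule that)
    show "countable (\<Union>n. bad (1 / real (Suc n)))"
      by (intro countable_UN) (auto intro!: countable_finite fin)
    fix U assume U: "clopen U" "U \<inter> (\<Union>n. bad (1 / real (Suc n))) = {}"
    have small: "\<exists>V. clopen V \<and> x \<in> V \<and> (\<forall>W. clopen W \<and> x \<in> W \<and> W \<subseteq> V \<longrightarrow> norm (m W) \<le> \<epsilon>)"
      if "x \<in> U" "\<epsilon> > 0" for x \<epsilon>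
    proof -
      obtain n where n: "1 / real (Suc n) < \<epsilon>" using nat_approx_posE[OF \<open>\<epsilon> > 0\<close>] by metis
      have "x \<notin> bad (1 / real (Suc n))" using U(2) that(1) by blast
      then obtain V where "clopen V" "x \<in> V"
        "\<forall>W. clopen W \<and> x \<in> W \<and> W \<subseteq> V \<longrightarrow> norm (m W) \<le> 1 / real (Suc n)"
        unfolding bad_def not_less[symmetric] by blast
      with n show ?thesis by (meson less_imp_le order_trans)
    qed
    \<comment> \<open>Vanishing on all clopen subsets, unlike \<open>m V = 0\<close> alone, is
      preserved by finite unions.\<close>
    define null where "null V \<longleftrightarrow> clopen V \<and> (\<forall>W. clopen W \<and> W \<subseteq> V \<longrightarrow> m W = 0)" for V
    have null_Un: "null (V1 \<union> V2)" if "null V1" "null V2" for V1 V2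
      unfolding null_def
    proof (intro conjI allI impI)
      show "clopen (V1 \<union> V2)" using that by (simp add: null_def clopen_Un)
      fix W assume W: "clopen W \<and> W \<subseteq> V1 \<union> V2"
      have "m (W \<inter> V1 \<union> (W - V1)) = m (W \<inter> V1) + m (W - V1)"
        using that W by (intro add) (auto simp: null_def clopen_Int clopen_Diff)
      moreover have "m (W \<inter> V1) = 0" using that(1) W by (simp add: null_def clopen_Int)
      moreover have "m (W - V1) = 0"
      proof -
        have "W - V1 \<subseteq> V2" using W by auto
        then show ?thesis using that W by (simp add: null_def clopen_Diff)
      qed
      moreover have "W \<inter> V1 \<union> (W - V1) = W" by auto
      ultimately show "m W = 0" by simp
    qed
    have null_empty: "null {}"
      using add[of "{}" "{}"] by (auto simp: null_def clopen_empty)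
    have null_cover: "m W = 0" if W: "clopen W" "\<And>x. x \<in> W \<Longrightarrow> \<exists>V. null V \<and> x \<in> V" for W
    proof -
      obtain V where V: "\<And>x. x \<in> W \<Longrightarrow> null (V x) \<and> x \<in> V x" using W(2) by metis
      have "compact W" using compact_Int_closed[OF K, of W] W(1) by (simp add: clopen_def)
      then obtain C where C: "C \<subseteq> W" "finite C" "W \<subseteq> (\<Union>x\<in>C. V x)"
        by (rule compactE_image[of W W V]) (use V in \<open>auto simp: null_def clopen_def\<close>)
      have "null (\<Union>x\<in>C. V x)"
        using C(2,1) by (induction C) (use V in \<open>auto intro!: null_Un null_empty\<close>)
      with C(3) W(1) show ?thesis by (simp add: null_def)
    qed
    \<comment> \<open>As for the clopen base, exceptional points are excluded by examining an
      isolated one.\<close>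
    define A where "A = {x \<in> U. \<forall>V. null V \<longrightarrow> x \<notin> V}"
    have "A = {}"
    proof (rule ccontr)
      assume "A \<noteq> {}"
      then obtain z T where z: "z \<in> A" and T: "open T" "T \<inter> A = {z}"
        using scattered_isolated_point[OF sc subset_UNIV] by metis
      have UT: "open (U \<inter> T)" "z \<in> U \<inter> T" using U(1) T z by (auto simp: clopen_def A_def)
      obtain V where V: "clopen V" "z \<in> V" "V \<subseteq> U \<inter> T"
        by (rule scattered_compact_clopen_base[OF K sc UT])
      have away: "m W = 0" if "clopen W" "W \<subseteq> V" "z \<notin> W" for W
      proof (rule null_cover[OF that(1)])
        fix x assume "x \<in> W"
        then have "x \<in> U" "x \<notin> A" using that V(3) T(2) by auto
        then show "\<exists>V. null V \<and> x \<in> V" by (auto simp: A_def)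
      qed
      have "m W = 0" if W: "clopen W" "W \<subseteq> V" for W
      proof (cases "z \<in> W")
        case True
        \<comment> \<open>\<open>W\<close> is split along \<open>V'\<close>: the part around
          \<open>z\<close> is small since \<open>z\<close> is in no \<open>bad\<close> set, and the
          part away from \<open>z\<close> is null by \<open>away\<close>.\<close>
        have "norm (m W) \<le> \<epsilon>" if \<epsilon>: "\<epsilon> > 0" for \<epsilon>
        proof -
          have "z \<in> U" using z by (simp add: A_def)
          from small[OF this \<epsilon>]
          obtain V' where V': "clopen V'" "z \<in> V'"
            "\<And>W. clopen W \<Longrightarrow> z \<in> W \<Longrightarrow> W \<subseteq> V' \<Longrightarrow> norm (m W) \<le> \<epsilon>"
            by blast
          have "m (W \<inter> V' \<union> (W - V')) = m (W \<inter> V') + m (W - V')"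
            using W V' by (intro add) (auto simp: clopen_Int clopen_Diff)
          moreover have "m (W - V') = 0"
            by (rule away) (use W V' in \<open>auto simp: clopen_Diff\<close>)
          moreover have "norm (m (W \<inter> V')) \<le> \<epsilon>"
            by (rule V'(3)) (use W V' True in \<open>auto simp: clopen_Int\<close>)
          moreover have "W \<inter> V' \<union> (W - V') = W" by auto
          ultimately show ?thesis by simp
        qed
        then have "norm (m W) \<le> 0" using field_le_epsilon[of "norm (m W)" 0] by simp
        then show ?thesis by simp
      qed (use away W in auto)
      then have "null V" using V(1) by (simp add: null_def)
      with z V(2) show False by (auto simp: A_def)
    qed
    then show "m U = 0" by (intro null_cover[OF U(1)]) (auto simp: A_def)
  qed
qed

section \<open>Closures in Eberlein compact spaces\<close>

lemma countable_ordLeq_infinite: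
  assumes "countable A" "infinite B"
  shows "|A| \<le>o |B|"
proof -
  obtain f :: "'a \<Rightarrow> nat" where "inj_on f A" using assms(1) by (auto simp: countable_def)
  then have "|A| \<le>o |UNIV :: nat set|" by (rule card_of_ordLeqI) simp
  also have "|UNIV :: nat set| \<le>o |B|" using assms(2) by (simp add: infinite_iff_card_of_nat)
  finally show ?thesis .
qed

lemma card_of_lists_ordLeq_infinite:
  assumes "|A| \<le>o |B|" "infinite B"
  shows "|lists A| \<le>o |B|"
proof -
  have len: "|{xs \<in> lists A. length xs = n}| \<le>o |B|" for n
  proof (induction n)
    case 0
    have "{xs \<in> lists A. length xs = 0} = {[]}" by auto
    then show ?case
      using card_of_singl_ordLeq[OF infinite_imp_nonempty[OF assms(2)], of "[]"] by (simp only:)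
  next
    case (Suc n)
    have "{xs \<in> lists A. length xs = Suc n} \<subseteq> (\<lambda>(x, xs). x # xs) ` (A \<times> {xs \<in> lists A. length xs = n})"
      by (auto simp: length_Suc_conv image_iff)
    then have "|{xs \<in> lists A. length xs = Suc n}| \<le>o |A \<times> {xs \<in> lists A. length xs = n}|"
      by (rule surj_imp_ordLeq)
    also have "|A \<times> {xs \<in> lists A. length xs = n}| \<le>o |B|"
      by (rule card_of_Sigma_ordLeq_infinite[OF assms(2,1)]) (simp add: Suc)
    finally show ?case .
  qed
  have "lists A = (\<Union>n. {xs \<in> lists A. length xs = n})" by auto
  moreover have "|\<Union>n. {xs \<in> lists A. length xs = n}| \<le>o |B|"
    by (rule card_of_UNION_ordLeq_infinite[OF assms(2)])
      (use len infinite_iff_card_of_nat assms(2) in blast)+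
  ultimately show ?thesis by simp
qed

text \<open>Within \<open>D\<close> each point is singled out by finitely many conditions
  "\<open>\<phi>\<close> is below \<open>q\<close>" with \<open>q\<close> rational; compactness of
  \<open>C - T\<close> makes finitely many suffice. There are at most \<open>|L|\<close> finite
  lists of such conditions.\<close>

lemma card_of_discrete_ordLeq:
  fixes C D :: "'a::topological_space set" and \<Phi> :: "('a \<Rightarrow> real) set"
  assumes C: "compact C" "D \<subseteq> C"
    and disc: "\<And>x. x \<in> D \<Longrightarrow> \<exists>T. open T \<and> T \<inter> D = {x}"
    and cont: "\<And>\<phi>. \<phi> \<in> \<Phi> \<Longrightarrow> continuous_on UNIV \<phi>"
    and sep: "\<And>x z. x \<in> C \<Longrightarrow> z \<in> C \<Longrightarrow> x \<noteq> z \<Longrightarrow> \<exists>\<phi>\<in>\<Phi>. \<phi> x < \<phi> z"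
    and card: "|\<Phi>| \<le>o |L|" "infinite L"
  shows "|D| \<le>o |L|"
proof -
  define P where "P = (\<lambda>(\<phi> :: 'a \<Rightarrow> real, q). \<phi> -` {..<real_of_rat q})"
  define I where "I l = (\<Inter>p\<in>set l. P p)" for l
  have "\<exists>l \<in> lists (\<Phi> \<times> UNIV). x \<in> I l \<and> I l \<inter> D \<subseteq> {x}" if x: "x \<in> D" for x
  proof -
    obtain T where T: "open T" "T \<inter> D = {x}" using disc[OF x] by blast
    \<comment> \<open>A rational between the two values gives a condition that holds at
      \<open>x\<close> and fails on a neighbourhood of \<open>z\<close>.\<close>
    have "\<exists>p N. p \<in> \<Phi> \<times> UNIV \<and> open N \<and> z \<in> N \<and> x \<in> P p \<and> N \<inter> P p = {}" if z: "z \<in> C - T" for z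
    proof -
      have "x \<noteq> z" "x \<in> C" "z \<in> C" using z x T(2) C(2) by blast+
      then obtain \<phi> where \<phi>: "\<phi> \<in> \<Phi>" "\<phi> x < \<phi> z" using sep by blast
      then obtain q where q: "\<phi> x < real_of_rat q" "real_of_rat q < \<phi> z" using of_rat_dense by blast
      have "open (\<phi> -` {real_of_rat q<..})" by (intro open_vimage cont \<phi>) simp
      then show ?thesis
        using \<phi> q by (intro exI[of _ "(\<phi>, q)"] exI[of _ "\<phi> -` {real_of_rat q<..}"]) (auto simp: P_def)
    qed
    then obtain p N where pN: "\<And>z. z \<in> C - T \<Longrightarrow>
        p z \<in> \<Phi> \<times> UNIV \<and> open (N z) \<and> z \<in> N z \<and> x \<in> P (p z) \<and> N z \<inter> P (p z) = {}"
      by metis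
    have "compact (C - T)" using C(1) T(1) by (rule compact_diff)
    then obtain Y where Y: "Y \<subseteq> C - T" "finite Y" "C - T \<subseteq> (\<Union>y\<in>Y. N y)"
      by (rule compactE_image[of "C - T" "C - T" N]) (use pN in auto)
    obtain l where l: "set l = p ` Y" using finite_list[OF finite_imageI[OF Y(2)]] by metis
    have mem: "p y \<in> \<Phi> \<times> UNIV" "x \<in> P (p y)" "N y \<inter> P (p y) = {}" if "y \<in> Y" for y
      using pN[of y] Y(1) that by blast+
    have "l \<in> lists (\<Phi> \<times> UNIV)" using mem(1) unfolding in_lists_conv_set l by blast
    moreover have "x \<in> I l" using mem(2) by (simp add: I_def l)
    moreover have "I l \<inter> D \<subseteq> {x}"
    proof
      fix z assume z: "z \<in> I l \<inter> D"
      have "z \<in> T"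
      proof (rule ccontr)
        assume "z \<notin> T"
        then obtain y where "y \<in> Y" "z \<in> N y" using z Y(3) C(2) by blast
        moreover have "z \<in> P (p y)" using z \<open>y \<in> Y\<close> by (simp add: I_def l)
        ultimately show False using mem(3) by blast
      qed
      with z T(2) show "z \<in> {x}" by blast
    qed
    ultimately show ?thesis by blast
  qed
  then obtain l where l: "\<And>x. x \<in> D \<Longrightarrow> l x \<in> lists (\<Phi> \<times> UNIV) \<and> x \<in> I (l x) \<and> I (l x) \<inter> D \<subseteq> {x}"
    by metis
  have "inj_on l D"
  proof (rule inj_onI)
    fix x y assume xy: "x \<in> D" "y \<in> D" "l x = l y"
    then have "y \<in> I (l x) \<inter> D" using l[of y] by simp
    then show "x = y" using l[of x] xy(1) by blast
  qed
  then have "|D| \<le>o |lists (\<Phi> \<times> (UNIV :: rat set))|"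
    by (rule card_of_ordLeqI) (use l in blast)
  also have "|lists (\<Phi> \<times> (UNIV :: rat set))| \<le>o |L|"
  proof (rule card_of_lists_ordLeq_infinite[OF _ card(2)])
    have "|UNIV :: rat set| \<le>o |L|" using card(2) by (intro countable_ordLeq_infinite) auto
    then show "|\<Phi> \<times> (UNIV :: rat set)| \<le>o |L|"
      by (intro card_of_Sigma_ordLeq_infinite[OF card(2,1)]) simp
  qed
  finally show ?thesis .
qed

text \<open>\<open>Q\<close> is the set of rational combinations, coded by lists so that it can be
  counted and so that addition is concatenation. Taking the closure restores real scalars.\<close>

lemma small_dense_rational_span:
  fixes V :: "'x::real_normed_vector set"
  assumes card: "|V| \<le>o |L|" "infinite L"
  obtains Q where "V \<subseteq> Q" "|Q| \<le>o |L|" "subspace (closure Q)"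
proof -
  define c where "c l = (\<Sum>(q, v)\<leftarrow>l. real_of_rat q *\<^sub>R v)" for l :: "(rat \<times> 'x) list"
  define Q where "Q = c ` lists (UNIV \<times> V)"
  have QI: "c l \<in> Q" if "l \<in> lists (UNIV \<times> V)" for l using that by (simp add: Q_def)
  have zero: "0 \<in> Q" using QI[of "[]"] by (simp add: c_def)
  have add: "x + y \<in> Q" if "x \<in> Q" "y \<in> Q" for x y
  proof -
    obtain k l where kl: "x = c k" "y = c l" "k \<in> lists (UNIV \<times> V)" "l \<in> lists (UNIV \<times> V)"
      using \<open>x \<in> Q\<close> \<open>y \<in> Q\<close> unfolding Q_def by blast
    have "c (k @ l) = x + y" by (simp add: c_def kl)
    with QI[of "k @ l"] kl show ?thesis by simp
  qed
  have scale: "real_of_rat r *\<^sub>R x \<in> Q" if "x \<in> Q" for x r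
  proof -
    obtain l where l: "x = c l" "l \<in> lists (UNIV \<times> V)" using \<open>x \<in> Q\<close> unfolding Q_def by blast
    have "c (map (\<lambda>(q, v). (r * q, v)) l) = real_of_rat r *\<^sub>R c l"
      by (induction l) (auto simp: c_def scaleR_add_right of_rat_mult)
    moreover have "map (\<lambda>(q, v). (r * q, v)) l \<in> lists (UNIV \<times> V)"
      using l(2) by (induction l) auto
    ultimately show ?thesis using QI l(1) by metis
  qed
  show thesis
  proof (rule that)
    show "V \<subseteq> Q"
    proof
      fix v assume "v \<in> V"
      then show "v \<in> Q" using QI[of "[(1, v)]"] by (simp add: c_def)
    qed
    have "|Q| \<le>o |lists ((UNIV :: rat set) \<times> V)|" unfolding Q_def by (rule card_of_image)
    also have "|lists ((UNIV :: rat set) \<times> V)| \<le>o |L|"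
    proof (rule card_of_lists_ordLeq_infinite[OF _ card(2)])
      have "|UNIV :: rat set| \<le>o |L|" using card(2) by (intro countable_ordLeq_infinite) auto
      then show "|(UNIV :: rat set) \<times> V| \<le>o |L|"
        by (intro card_of_Sigma_ordLeq_infinite[OF card(2)]) (simp_all add: card(1))
    qed
    finally show "|Q| \<le>o |L|" .
    show "subspace (closure Q)"
    proof (rule subspaceI)
      show "0 \<in> closure Q" using zero closure_subset by blast
    next
      fix x y assume "x \<in> closure Q" "y \<in> closure Q"
      then obtain f g where fg: "\<And>n. f n \<in> Q" "f \<longlonglongrightarrow> x" "\<And>n. g n \<in> Q" "g \<longlonglongrightarrow> y"
        unfolding closure_sequential by blast
      then have "\<And>n. f n + g n \<in> Q" "(\<lambda>n. f n + g n) \<longlonglongrightarrow> x + y"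
        by (auto intro: add tendsto_add)
      then show "x + y \<in> closure Q" unfolding closure_sequential by (intro exI[of _ "\<lambda>n. f n + g n"]) blast
    next
      fix a :: real and x assume "x \<in> closure Q"
      then obtain f where f: "\<And>n. f n \<in> Q" "f \<longlonglongrightarrow> x"
        unfolding closure_sequential by blast
      have "\<exists>r. a < real_of_rat r \<and> real_of_rat r < a + 1 / real (Suc n)" for n
        by (rule of_rat_dense) simp
      then obtain r where r: "\<And>n. a < real_of_rat (r n)" "\<And>n. real_of_rat (r n) < a + 1 / real (Suc n)"
        by metis
      have "(\<lambda>n. a + 1 / real (Suc n)) \<longlonglongrightarrow> a + 0"
        by (intro tendsto_intros LIMSEQ_Suc[OF lim_1_over_n])
      then have up: "(\<lambda>n. a + 1 / real (Suc n)) \<longlonglongrightarrow> a" by simp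
      have "(\<lambda>n. real_of_rat (r n)) \<longlonglongrightarrow> a"
        by (rule real_tendsto_sandwich[OF always_eventually always_eventually tendsto_const up])
          (use r less_imp_le in blast)+
      then have "(\<lambda>n. real_of_rat (r n) *\<^sub>R f n) \<longlonglongrightarrow> a *\<^sub>R x"
        using f(2) by (rule tendsto_scaleR)
      moreover have "\<And>n. real_of_rat (r n) *\<^sub>R f n \<in> Q" using f(1) by (rule scale)
      ultimately show "a *\<^sub>R x \<in> closure Q"
        unfolding closure_sequential by (intro exI[of _ "\<lambda>n. real_of_rat (r n) *\<^sub>R f n"]) blast
    qed
  qed
qed

section \<open>Weak closures in Eberlein compact spaces\<close>

lemma eberlein_compact_embedding:
  assumes "eberlein_compact TYPE('k::t2_space) TYPE('x::banach)"
  obtains h :: "'k::t2_space \<Rightarrow> 'x::banach" where "inj h"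
    "\<And>f :: 'x \<Rightarrow> real. bounded_linear f \<Longrightarrow> continuous_on UNIV (\<lambda>t. f (h t))"
proof -
  obtain W :: "'x set" where
    "(euclidean :: 'k topology) homeomorphic_space subtopology weak_topology W"
    using assms by (auto simp: eberlein_compact_def)
  then obtain h g where h: "homeomorphic_maps (euclidean :: 'k topology) (subtopology weak_topology W) h g"
    by (auto simp: homeomorphic_space_def)
  have "inj h" by (rule inj_on_inverseI[of _ g]) (use h in \<open>simp add: homeomorphic_maps_def\<close>)
  moreover have "continuous_on UNIV (\<lambda>t. f (h t))" if f: "bounded_linear f" for f :: "'x \<Rightarrow> real"
  proof -
    have "continuous_map euclidean weak_topology h"
      using h by (simp add: homeomorphic_maps_def continuous_map_in_subtopology)
    then have *: "open {t. h t \<in> O'}" if "openin weak_topology O'" for O'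
      using that by (auto simp: continuous_map_def)
    have "open ((\<lambda>t. f (h t)) -` U)" if "open U" for U
    proof -
      have "openin (weak_topology :: 'x topology) (f -` U)"
        unfolding weak_topology_def by (rule topology_generated_by_Basis) (use f that in blast)
      from *[OF this] show ?thesis by (simp add: vimage_def)
    qed
    then show ?thesis by (simp add: continuous_on_open_vimage)
  qed
  ultimately show thesis using that by blast
qed

text \<open>
  The weak closure of a set of cardinality at most \<open>|L|\<close> lies in a norm closed subspace with a dense
  set of that size, so \<open>|L|\<close> functionals separate its points.
\<close>

lemma eberlein_card_of_closure_ordLeq:
  fixes S :: "'k::t2_space set"
  assumes eb: "eberlein_compact TYPE('k) TYPE('x::banach)"
    and D: "UNIV = (\<Union>n::nat. D n)" "\<And>n x. x \<in> D n \<Longrightarrow> \<exists>T::'k set. open T \<and> T \<inter> D n = {x}"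
    and card: "|S| \<le>o |L|" "infinite L"
  shows "|closure S| \<le>o |L|"
proof -
  have K: "compact (UNIV :: 'k set)" using eb by (simp add: eberlein_compact_def)
  obtain h :: "'k \<Rightarrow> 'x" where h: "inj h"
    "\<And>f :: 'x \<Rightarrow> real. bounded_linear f \<Longrightarrow> continuous_on UNIV (\<lambda>t. f (h t))"
    using eberlein_compact_embedding[OF eb] by blast
  have "|h ` S| \<le>o |L|" using card_of_image card(1) by (rule ordLeq_transitive)
  then obtain Q where Q: "h ` S \<subseteq> Q" "|Q| \<le>o |L|" "subspace (closure Q)"
    using small_dense_rational_span[OF _ card(2)] by blast
  \<comment> \<open>A functional that annihilates \<open>closure Q\<close> is continuous along
    \<open>h\<close>, hence vanishes on all of \<open>closure S\<close>.\<close>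
  have hQ: "h t \<in> closure Q" if t: "t \<in> closure S" for t
  proof (rule ccontr)
    assume "h t \<notin> closure Q"
    then have "h t \<notin> closure (closure Q)" by simp
    then obtain f where f: "bounded_linear f" "\<And>y. y \<in> closure Q \<Longrightarrow> f y = (0::real)" "f (h t) \<noteq> 0"
      using annihilating_functional[OF Q(3)] by blast
    have "closed {t. f (h t) = 0}"
      using h(2)[OF f(1)] by (intro closed_Collect_eq) auto
    moreover have "S \<subseteq> {t. f (h t) = 0}"
      using f(2) Q(1) closure_subset by blast
    ultimately have "closure S \<subseteq> {t. f (h t) = 0}" by (simp add: closure_minimal)
    with t f(3) show False by blast
  qed
  have "\<exists>f. bounded_linear f \<and> (\<forall>x. \<bar>f x\<bar> \<le> norm x) \<and> f q = norm q" for q :: 'x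
    by (metis norming_functional)
  then obtain e :: "'x \<Rightarrow> 'x \<Rightarrow> real" where e: "\<And>q. bounded_linear (e q)" "\<And>q x. \<bar>e q x\<bar> \<le> norm x"
    "\<And>q. e q q = norm q"
    by metis
  define \<Phi> where "\<Phi> = (\<lambda>q t. e q (h t)) ` Q"
  \<comment> \<open>The counting lemma is for discrete sets, so the closure is cut into the layers
    \<open>D n\<close>.\<close>
  have "|closure S \<inter> D n| \<le>o |L|" for n
  proof (rule card_of_discrete_ordLeq[where \<Phi> = \<Phi> and C = "closure S"])
    show "compact (closure S)" using compact_Int_closed[OF K, of "closure S"] by simp
    show "closure S \<inter> D n \<subseteq> closure S" by simp
    show "\<exists>T. open T \<and> T \<inter> (closure S \<inter> D n) = {x}" if x: "x \<in> closure S \<inter> D n" for x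
    proof -
      obtain T where "open T" "T \<inter> D n = {x}" using D(2) x by blast
      then show ?thesis using x by (intro exI[of _ T]) blast
    qed
    show "continuous_on UNIV \<phi>" if "\<phi> \<in> \<Phi>" for \<phi> using that h(2) e(1) by (auto simp: \<Phi>_def)
    have "|\<Phi>| \<le>o |Q|" unfolding \<Phi>_def by (rule card_of_image)
    then show "|\<Phi>| \<le>o |L|" using Q(2) by (rule ordLeq_transitive)
    show "\<exists>\<phi>\<in>\<Phi>. \<phi> x < \<phi> z" if xz: "x \<in> closure S" "z \<in> closure S" "x \<noteq> z" for x z
    proof -
      define w where "w = h z - h x"
      have "w \<noteq> 0" using h(1) xz(3) by (auto simp: w_def inj_eq)
      have "w \<in> closure Q" unfolding w_def using hQ xz(1,2) by (intro subspace_diff[OF Q(3)])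
      then obtain q where q: "q \<in> Q" "dist q w < norm w / 3"
        using \<open>w \<noteq> 0\<close> unfolding closure_approachable by (metis divide_pos_pos zero_less_norm_iff zero_less_numeral)
      interpret bounded_linear "e q" by (rule e(1))
      have "e q w = norm q - e q (q - w)" by (simp add: diff e(3))
      moreover have "e q (q - w) \<le> norm (q - w)" using e(2)[of q "q - w"] by linarith
      moreover have "norm w \<le> norm q + norm (q - w)"
        by (metis add.commute diff_add_cancel norm_minus_commute norm_triangle_ineq)
      moreover have "norm w > 0" using \<open>w \<noteq> 0\<close> by simp
      ultimately have "e q w > 0" using q(2) unfolding dist_norm by linarith
      then have "e q (h x) < e q (h z)" by (simp add: w_def diff)
      then show ?thesis using q(1) by (auto simp: \<Phi>_def)
    qed
  qed (rule card(2))
  then have "|\<Union>n::nat. closure S \<inter> D n| \<le>o |L|"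
    by (intro card_of_UNION_ordLeq_infinite[OF card(2)])
      (use card(2) infinite_iff_card_of_nat in blast)+
  moreover have "closure S = (\<Union>n. closure S \<inter> D n)" using D(1) by blast
  ultimately show ?thesis by simp
qed

section \<open>Operators on spaces of continuous functions\<close>

text \<open>Meant for clopen \<open>V\<close>, where the indicator is continuous and
  \<open>Bcontfun\<close> returns it unchanged.\<close>

definition chi :: "'a::t2_space set \<Rightarrow> 'a \<Rightarrow>\<^sub>C real" where
  "chi V = Bcontfun (indicator V)"

lemma apply_chi:
  assumes "clopen V"
  shows "apply_bcontfun (chi V) = indicator V"
proof -
  have "isCont (indicator V :: 'a \<Rightarrow> real) x" for x
    using assms by (simp add: isCont_indicator clopen_def frontier_def interior_open)
  then have "continuous_on UNIV (indicator V :: 'a \<Rightarrow> real)"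
    by (simp add: continuous_on_eq_continuous_at)
  then have "(indicator V :: 'a \<Rightarrow> real) \<in> bcontfun"
    by (rule bcontfun_normI[where b = 1]) (simp add: indicator_def)
  then show ?thesis by (simp add: chi_def Bcontfun_inverse)
qed

lemma chi_disjoint_Un:
  assumes "clopen A" "clopen B" "A \<inter> B = {}"
  shows "chi (A \<union> B) = chi A + chi B"
  using assms by (intro bcontfun_eqI) (auto simp: plus_bcontfun.rep_eq apply_chi clopen_Un indicator_def)

lemma bounded_linear_apply_bcontfun: "bounded_linear (\<lambda>f. apply_bcontfun f x)"
  by (rule bounded_linear_intro[where K = 1])
    (simp_all add: plus_bcontfun.rep_eq scaleR_bcontfun.rep_eq norm_bounded)

lemma apply_sum_chi:
  assumes "\<And>j. j \<in> F \<Longrightarrow> clopen (V j)"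
  shows "apply_bcontfun (\<Sum>j\<in>F. c j *\<^sub>R chi (V j)) x = (\<Sum>j\<in>F. c j * indicator (V j) x)"
proof -
  interpret ev: bounded_linear "\<lambda>f. apply_bcontfun f x" by (rule bounded_linear_apply_bcontfun)
  show ?thesis using assms by (simp add: ev.sum ev.scale apply_chi)
qed

text \<open>At every point at most one summand is nonzero.\<close>

lemma norm_disjoint_chi_sum_le:
  assumes V: "\<And>j. clopen (V j)" "disjoint_family V" and F: "finite F"
    and b: "b \<ge> 0" "\<And>j. j \<in> F \<Longrightarrow> \<bar>c j\<bar> \<le> b"
  shows "norm (\<Sum>j\<in>F. c j *\<^sub>R chi (V j)) \<le> b"
proof (rule norm_bound)
  fix x
  have "\<bar>\<Sum>j\<in>F. c j * indicator (V j) x\<bar> \<le> b"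
  proof (cases "\<exists>i\<in>F. x \<in> V i")
    case True
    then obtain i where i: "i \<in> F" "x \<in> V i" by blast
    have "x \<notin> V j" if "j \<noteq> i" for j
      using V(2) i(2) that by (auto simp: disjoint_family_on_def)
    then have "(\<Sum>j\<in>F. c j * indicator (V j) x) = (\<Sum>j\<in>F. if j = i then c j else 0)"
      using i(2) by (intro sum.cong) auto
    also have "\<dots> = c i" using F i(1) by simp
    finally show ?thesis using b(2)[OF i(1)] by simp
  next
    case False
    then have "(\<Sum>j\<in>F. c j * indicator (V j) x) = 0" by (intro sum.neutral) auto
    then show ?thesis using b(1) by simp
  qed
  then show "norm (apply_bcontfun (\<Sum>j\<in>F. c j *\<^sub>R chi (V j)) x) \<le> b"
    by (simp add: apply_sum_chi V(1))
qed

text \<open>Indicators of disjoint clopen sets behave like unit vectors of \<open>c0\<close>, so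
  their images satisfy the bound in \<open>tendsto_0_if_no_c0\<close>.\<close>

lemma chi_exhaustive_if_no_c0:
  fixes R :: "('a::t2_space \<Rightarrow>\<^sub>C real) \<Rightarrow> 'e::banach"
  assumes R: "bounded_linear R" and no_c0: "\<nexists>F::'e set. linearly_homeomorphic c0 F"
    and V: "\<And>n::nat. clopen (V n)" "disjoint_family V"
  shows "(\<lambda>n. R (chi (V n))) \<longlonglongrightarrow> 0"
proof -
  interpret bounded_linear R by (rule R)
  obtain M where M: "M \<ge> 0" "\<And>f. norm (R f) \<le> norm f * M" using nonneg_bounded by blast
  show ?thesis
  proof (rule tendsto_0_if_no_c0[OF no_c0, where M = M])
    fix F :: "nat set" and c :: "nat \<Rightarrow> real" and b :: real
    assume Fb: "finite F" "b \<ge> 0" "\<And>j. j \<in> F \<Longrightarrow> \<bar>c j\<bar> \<le> b"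
    have "(\<Sum>j\<in>F. c j *\<^sub>R R (chi (V j))) = R (\<Sum>j\<in>F. c j *\<^sub>R chi (V j))"
      by (simp add: sum scale)
    also have "norm \<dots> \<le> norm (\<Sum>j\<in>F. c j *\<^sub>R chi (V j)) * M" by (rule M(2))
    also have "\<dots> \<le> b * M"
      using norm_disjoint_chi_sum_le[OF V Fb] M(1) by (rule mult_right_mono)
    finally show "norm (\<Sum>j\<in>F. c j *\<^sub>R R (chi (V j))) \<le> M * b" by (simp add: mult.commute)
  qed
qed

section \<open>Nested indicators whose images rarely overlap\<close>

lemma closed_finite_if_no_accumulation:
  fixes B X :: "'a::t2_space set"
  assumes K: "compact (UNIV :: 'a set)" and B: "closed B" "closed X" "B \<inter> accumulation_points X = {}"
  shows "finite (B \<inter> X)"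
proof (rule ccontr)
  assume "infinite (B \<inter> X)"
  moreover have "compact (B \<inter> X)" using compact_Int_closed[OF K, of "B \<inter> X"] B by (simp add: closed_Int)
  ultimately obtain x where x: "x \<in> B \<inter> X" "x islimpt B \<inter> X"
    using Heine_Borel_imp_Bolzano_Weierstrass[of "B \<inter> X" "B \<inter> X"] by blast
  then have "x islimpt X" using islimpt_subset by blast
  with x B(3) show False by (auto simp: accumulation_points_def)
qed

text \<open>
  With \<open>A j = {y. \<epsilon> \<le> norm (T (chi (V j)) y)}\<close>, the last conclusion says that the intersection of the
  \<open>A j\<close> over \<open>J\<close> misses the derivative of order \<open>n + 1 - card J\<close>. It persists since \<open>A (Suc k)\<close> is
  made to avoid the finitely many points of highest possible rank in each earlier intersection.
\<close>

lemma nested_clopen_family: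
  fixes T :: "('a::t2_space \<Rightarrow>\<^sub>C real) \<Rightarrow> ('b::t2_space \<Rightarrow>\<^sub>C 'e::banach)"
  assumes K1: "compact (UNIV :: 'a set)" "scattered (UNIV :: 'a set)" and K2: "compact (UNIV :: 'b set)"
    and T: "bounded_linear T" and no_c0: "\<nexists>F::'e set. linearly_homeomorphic c0 F"
    and U: "clopen U" "U \<inter> cb_deriv UNIV 0 N \<noteq> {}"
    and vanish: "\<And>V y. clopen V \<Longrightarrow> V \<subseteq> U \<Longrightarrow> y \<in> cb_deriv UNIV 0 n \<Longrightarrow> apply_bcontfun (T (chi V)) y = 0"
    and "\<epsilon> > 0" "k \<le> N"
  obtains V :: "nat \<Rightarrow> 'a set" where "\<And>j. j \<le> k \<Longrightarrow> clopen (V j) \<and> V j \<subseteq> U \<and> V k \<subseteq> V j"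
    "V k \<inter> cb_deriv UNIV 0 (N - k) \<noteq> {}"
    "\<And>J r y. J \<subseteq> {..k} \<Longrightarrow> J \<noteq> {} \<Longrightarrow> n < r + card J \<Longrightarrow> y \<in> cb_deriv UNIV 0 r \<Longrightarrow>
      \<exists>j\<in>J. norm (apply_bcontfun (T (chi (V j))) y) < \<epsilon>"
proof -
  define A where "A W = {y. \<epsilon> \<le> norm (apply_bcontfun (T (chi W)) y)}" for W
  define cl where "cl V k \<longleftrightarrow> (\<forall>j\<le>k. clopen (V j) \<and> V j \<subseteq> U \<and> V k \<subseteq> V j)" for V and k :: nat
  define lev where "lev V k \<longleftrightarrow> V k \<inter> cb_deriv UNIV 0 (N - k) \<noteq> {}" for V :: "nat \<Rightarrow> 'a set" and k
  define sep where "sep V k \<longleftrightarrow> (\<forall>J r. J \<subseteq> {..k} \<longrightarrow> J \<noteq> {} \<longrightarrow> n < r + card J \<longrightarrow>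
      (\<Inter>j\<in>J. A (V j)) \<inter> cb_deriv UNIV 0 r = {})" for V and k :: nat
  have closedA: "closed (A W)" for W
    unfolding A_def by (intro closed_Collect_le continuous_intros continuous_on_apply_bcontfun)
  have "\<exists>V. cl V k \<and> lev V k \<and> sep V k"
    using \<open>k \<le> N\<close>
  proof (induction k)
    case 0
    define V :: "nat \<Rightarrow> 'a set" where "V = (\<lambda>_. U)"
    have "cl V 0" "lev V 0" using U by (simp_all add: cl_def lev_def V_def)
    moreover have "sep V 0"
      unfolding sep_def
    proof (intro allI impI)
      fix J r assume J: "J \<subseteq> {..0::nat}" "J \<noteq> {}" "n < r + card J"
      have "card J \<le> card {..0::nat}" by (rule card_mono) (use J in auto)
      then have "n \<le> r" using J(3) by simp
      have "y \<notin> A U" if "y \<in> cb_deriv UNIV 0 r" for y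
      proof -
        have "y \<in> cb_deriv UNIV 0 n" using that cb_deriv_antimono[OF \<open>n \<le> r\<close>] by blast
        then have "apply_bcontfun (T (chi U)) y = 0" by (intro vanish U) auto
        then show ?thesis using \<open>\<epsilon> > 0\<close> by (simp add: A_def)
      qed
      then show "(\<Inter>j\<in>J. A (V j)) \<inter> cb_deriv UNIV 0 r = {}"
        using J(2) by (auto simp: V_def)
    qed
    ultimately show ?case by blast
  next
    case (Suc k)
    then obtain V where V: "cl V k" "lev V k" "sep V k" by auto
    define top where "top J = (\<Inter>j\<in>J. A (V j)) \<inter> cb_deriv UNIV 0 (n - card J)" for J
    \<comment> \<open>The intersection misses the next derivative, so infinitely many points would
      accumulate at a forbidden one. If \<open>card J\<close> exceeds \<open>n\<close>, the
      truncated difference is 0 and the set is already empty.\<close>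
    have fin: "finite (top J)" if J: "J \<subseteq> {..k}" "J \<noteq> {}" for J
    proof (cases "card J \<le> n")
      case True
      have "(\<Inter>j\<in>J. A (V j)) \<inter> cb_deriv UNIV 0 (Suc (n - card J)) = {}"
        using V(3) J True unfolding sep_def by (metis Suc_diff_le add.commute le_add_diff_inverse lessI add_Suc_right)
      then show ?thesis
        unfolding top_def
        by (intro closed_finite_if_no_accumulation[OF K2] closed_INT ballI closedA closed_cb_deriv) simp_all
    next
      case False
      then have "n < 0 + card J" by simp
      then have "(\<Inter>j\<in>J. A (V j)) \<inter> cb_deriv UNIV 0 0 = {}"
        using V(3) J unfolding sep_def by blast
      then show ?thesis by (simp add: top_def)
    qed
    define F where "F = (\<Union>J\<in>{J. J \<subseteq> {..k} \<and> J \<noteq> {}}. top J)"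
    have "finite F"
      unfolding F_def
    proof (rule finite_UN_I)
      show "finite {J. J \<subseteq> {..k} \<and> J \<noteq> {}}" by (rule finite_subset[of _ "Pow {..k}"]) auto
    qed (use fin in blast)
    define P where "P = (cb_deriv UNIV 0 (N - Suc k) :: 'a set)"
    have Vk: "clopen (V k)" "V k \<subseteq> U" using V(1) by (auto simp: cl_def)
    \<comment> \<open>One order of derivative is spent here: a point of \<open>V k\<close> in the
      derivative of order \<open>N - k\<close> is a limit of points of \<open>P\<close>.\<close>
    have "infinite (P \<inter> V k)"
    proof -
      have "N - k = Suc (N - Suc k)" using Suc.prems by simp
      then obtain x where "x \<in> V k" "x islimpt P"
        using V(2) by (auto simp: lev_def P_def accumulation_points_def)
      then have "infinite (V k \<inter> P)"
        using Vk(1) by (simp add: islimpt_eq_acc_point clopen_def)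
      then show ?thesis by (simp add: Int_commute)
    qed
    \<comment> \<open>Disjointness makes the images of these candidates tend to 0 at each point, so
      one of them is small on all of the finite set \<open>F\<close>.\<close>
    then obtain W :: "nat \<Rightarrow> 'a set" where W: "\<And>i. clopen (W i)" "\<And>i. W i \<subseteq> V k" "\<And>i. P \<inter> W i \<noteq> {}"
      "disjoint_family W"
      using disjoint_clopen_sequence[OF K1 Vk(1), of P] by metis
    have "\<forall>\<^sub>F i in sequentially. norm (apply_bcontfun (T (chi (W i))) y) < \<epsilon>" for y
    proof -
      have "bounded_linear (\<lambda>f. apply_bcontfun (T f) y)"
        by (rule bounded_linear_compose[OF bounded_linear_apply_bcontfun T])
      from chi_exhaustive_if_no_c0[OF this no_c0 W(1,4)]
      show ?thesis using order_tendstoD(2)[OF tendsto_norm_zero] \<open>\<epsilon> > 0\<close> by blast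
    qed
    then have "\<forall>\<^sub>F i in sequentially. \<forall>y\<in>F. norm (apply_bcontfun (T (chi (W i))) y) < \<epsilon>"
      using \<open>finite F\<close> by (intro eventually_ball_finite) blast+
    then obtain i where i: "\<forall>y\<in>F. norm (apply_bcontfun (T (chi (W i))) y) < \<epsilon>"
      unfolding eventually_sequentially by blast
    define V' where "V' = V(Suc k := W i)"
    have V': "V' (Suc k) = W i" "\<And>j. j \<le> k \<Longrightarrow> V' j = V j" by (auto simp: V'_def)
    have "cl V' (Suc k)"
      unfolding cl_def
    proof (intro allI impI)
      fix j assume "j \<le> Suc k"
      then consider "j = Suc k" | "j \<le> k" by linarith
      then show "clopen (V' j) \<and> V' j \<subseteq> U \<and> V' (Suc k) \<subseteq> V' j"
      proof cases
        case 1
        then show ?thesis using W(1,2)[of i] Vk by (auto simp: V')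
      next
        case 2
        then show ?thesis using V(1) W(2)[of i] by (simp add: V' cl_def) blast
      qed
    qed
    moreover have "lev V' (Suc k)" using W(3)[of i] by (auto simp: lev_def V' P_def)
    moreover have "sep V' (Suc k)"
      unfolding sep_def
    proof (intro allI impI)
      fix J r assume J: "J \<subseteq> {..Suc k}" "J \<noteq> {}" "n < r + card J"
      define J' where "J' = J - {Suc k}"
      have J': "J' \<subseteq> {..k}" using J(1) by (auto simp: J'_def le_Suc_eq)
      have finJ: "finite J" using J(1) finite_subset by blast
      have eq: "(\<Inter>j\<in>J'. A (V' j)) = (\<Inter>j\<in>J'. A (V j))"
        using J' V'(2) by (intro INF_cong) auto
      have sub: "(\<Inter>j\<in>J. A (V' j)) \<subseteq> (\<Inter>j\<in>J'. A (V j))"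
        unfolding eq[symmetric] by (auto simp: J'_def)
      show "(\<Inter>j\<in>J. A (V' j)) \<inter> cb_deriv UNIV 0 r = {}"
      \<comment> \<open>Either the earlier sets suffice, or \<open>Suc k\<close> is in
        \<open>J\<close>. In the latter case, if \<open>J'\<close> is empty then
        \<open>n \<le> r\<close> and the image vanishes; otherwise \<open>r = n - card J'\<close>,
        the order whose points were collected in \<open>F\<close>.\<close>
      proof (cases "J' \<noteq> {} \<and> n < r + card J'")
        case True
        then have "(\<Inter>j\<in>J'. A (V j)) \<inter> cb_deriv UNIV 0 r = {}"
          using V(3) J' unfolding sep_def by blast
        then show ?thesis
          using Int_mono[OF sub order_refl[of "cb_deriv UNIV 0 r"]] by (simp only: subset_empty)
      next
        case False
        have top: "Suc k \<in> J"
          using False J by (auto simp: J'_def)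
        then have card: "card J = Suc (card J')" unfolding J'_def using finJ by (intro card.remove)
        have "y \<notin> A (W i)" if y: "y \<in> (\<Inter>j\<in>J. A (V' j))" "y \<in> cb_deriv UNIV 0 r" for y
        proof (cases "J' = {}")
          case True
          then have "n \<le> r" using J(3) card by simp
          then have "y \<in> cb_deriv UNIV 0 n" using y(2) cb_deriv_antimono by blast
          then have "apply_bcontfun (T (chi (W i))) y = 0"
            using W(1,2)[of i] Vk(2) by (intro vanish) auto
          then show ?thesis using \<open>\<epsilon> > 0\<close> by (simp add: A_def)
        next
          case J'ne: False
          then have "r = n - card J'" using False J(3) card by simp
          then have "y \<in> top J'" using y(2) subsetD[OF sub y(1)] unfolding top_def by (metis IntI)
          then have "y \<in> F" using J' J'ne by (auto simp: F_def)
          then show ?thesis using i by (auto simp: A_def not_le)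
        qed
        moreover have "y \<in> A (W i)" if "y \<in> (\<Inter>j\<in>J. A (V' j))" for y
          using INT_D[OF that top] V'(1) by simp
        ultimately show ?thesis by (intro equals0I) (elim IntE, metis)
      qed
    qed
    ultimately show ?case by blast
  qed
  then obtain V where V: "cl V k" "lev V k" "sep V k" by blast
  show thesis
  proof (rule that[of V])
    show "clopen (V j) \<and> V j \<subseteq> U \<and> V k \<subseteq> V j" if "j \<le> k" for j using V(1) that by (simp add: cl_def)
    show "V k \<inter> cb_deriv UNIV 0 (N - k) \<noteq> {}" using V(2) by (simp add: lev_def)
    show "\<exists>j\<in>J. norm (apply_bcontfun (T (chi (V j))) y) < \<epsilon>"
      if "J \<subseteq> {..k}" "J \<noteq> {}" "n < r + card J" "y \<in> cb_deriv UNIV 0 r" for J r y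
    proof -
      have "(\<Inter>j\<in>J. A (V j)) \<inter> cb_deriv UNIV 0 r = {}" using V(3) that unfolding sep_def by blast
      with that(4) have "\<exists>j\<in>J. y \<notin> A (V j)" by blast
      then show ?thesis by (simp add: A_def not_le)
    qed
  qed
qed

text \<open>The sum of the \<open>N + 1\<close> nested indicators has norm at least
  \<open>N + 1\<close>, since they share a point. At each point of the target at most
  \<open>n\<close> of their images reach \<open>\<epsilon>\<close>, and these are bounded by
  \<open>M\<close>.\<close>

lemma rank_bounded_by_distortion:
  fixes T :: "('a::t2_space \<Rightarrow>\<^sub>C real) \<Rightarrow> ('b::t2_space \<Rightarrow>\<^sub>C 'e::banach)"
  assumes K1: "compact (UNIV :: 'a set)" "scattered (UNIV :: 'a set)" and K2: "compact (UNIV :: 'b set)"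
    and T: "bounded_linear T" "\<And>f. norm (T f) \<le> M * norm f" "\<And>f. \<delta> * norm f \<le> norm (T f)" "\<delta> > 0"
    and no_c0: "\<nexists>F::'e set. linearly_homeomorphic c0 F"
    and U: "clopen U" "U \<inter> cb_deriv UNIV 0 N \<noteq> {}"
    and vanish: "\<And>V y. clopen V \<Longrightarrow> V \<subseteq> U \<Longrightarrow> y \<in> cb_deriv UNIV 0 n \<Longrightarrow> apply_bcontfun (T (chi V)) y = 0"
  shows "\<delta> * (real N + 1) \<le> 2 * real n * M"
proof -
  \<comment> \<open>The small terms then use up only half of the lower bound
    \<open>\<delta> * (real N + 1)\<close>, whence the factor 2 in the conclusion.\<close>
  define \<epsilon> where "\<epsilon> = \<delta> / 2"
  have \<epsilon>: "\<epsilon> > 0" using T(4) by (simp add: \<epsilon>_def)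
  obtain V :: "nat \<Rightarrow> 'a set" where V: "\<And>j. j \<le> N \<Longrightarrow> clopen (V j) \<and> V j \<subseteq> U \<and> V N \<subseteq> V j"
    "V N \<inter> cb_deriv UNIV 0 (N - N) \<noteq> {}"
    "\<And>J r y. J \<subseteq> {..N} \<Longrightarrow> J \<noteq> {} \<Longrightarrow> n < r + card J \<Longrightarrow> y \<in> cb_deriv UNIV 0 r \<Longrightarrow>
      \<exists>j\<in>J. norm (apply_bcontfun (T (chi (V j))) y) < \<epsilon>"
    using nested_clopen_family[OF K1 K2 T(1) no_c0 U vanish \<epsilon> order_refl] by blast
  interpret T: bounded_linear T by (rule T(1))
  define g where "g = (\<Sum>j\<le>N. 1 *\<^sub>R chi (V j))"
  obtain x where x: "x \<in> V N" using V(2) by blast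
  have xV: "x \<in> V j" if "j \<le> N" for j using V(1)[OF that] x by blast
  have "apply_bcontfun g x = (\<Sum>j\<le>N. 1 * indicator (V j) x)"
    unfolding g_def by (rule apply_sum_chi) (use V(1) in auto)
  also have "\<dots> = real N + 1" using xV by simp
  finally have "real N + 1 \<le> norm g" using norm_bounded[of g x] by simp
  have M: "norm (T (chi (V j))) \<le> M" if "j \<le> N" for j
  proof -
    have "norm (chi (V j)) \<le> 1" by (rule norm_bound) (use V(1)[OF that] in \<open>simp add: apply_chi indicator_def\<close>)
    moreover have "M \<ge> 0" using T(2)[of g] \<open>real N + 1 \<le> norm g\<close>
      by (metis add_nonneg_pos mult_less_0_iff norm_ge_zero not_less of_nat_0_le_iff order_trans zero_less_one less_le_trans)
    ultimately show ?thesis using T(2)[of "chi (V j)"] mult_left_mono[of "norm (chi (V j))" 1 M] by simp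
  qed
  have "norm (T g) \<le> real n * M + (real N + 1) * \<epsilon>"
  proof (rule norm_bound)
    fix y :: 'b
    interpret ev: bounded_linear "\<lambda>f. apply_bcontfun f y" by (rule bounded_linear_apply_bcontfun)
    define t where "t j = norm (apply_bcontfun (T (chi (V j))) y)" for j
    define J where "J = {j. j \<le> N \<and> \<epsilon> \<le> t j}"
    have tM: "t j \<le> M" if "j \<le> N" for j
      unfolding t_def using norm_bounded M[OF that] by (rule order_trans)
    \<comment> \<open>The separation property is used with \<open>r = 0\<close>, where the
      derivative is the whole space.\<close>
    have "card J \<le> n"
    proof (rule ccontr)
      assume "\<not> card J \<le> n"
      then have "J \<noteq> {}" "n < 0 + card J" by auto
      then obtain j where "j \<in> J" "t j < \<epsilon>"
        using V(3)[of J 0 y] unfolding t_def by (auto simp: J_def)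
      then show False by (simp add: J_def)
    qed
    have "apply_bcontfun (T g) y = (\<Sum>j\<le>N. apply_bcontfun (T (chi (V j))) y)"
      by (simp add: g_def T.sum ev.sum)
    also have "norm \<dots> \<le> (\<Sum>j\<le>N. t j)" unfolding t_def by (rule norm_sum)
    also have "\<dots> \<le> (\<Sum>j\<le>N. (if j \<in> J then M else 0) + \<epsilon>)"
      by (rule sum_mono) (use tM \<epsilon> in \<open>force simp: J_def\<close>)
    also have "\<dots> = real (card J) * M + (real N + 1) * \<epsilon>"
    proof -
      have "{..N} \<inter> J = J" by (auto simp: J_def)
      then show ?thesis by (simp add: sum.distrib sum.If_cases)
    qed
    also have "\<dots> \<le> real n * M + (real N + 1) * \<epsilon>"
    proof -
      have "0 \<le> t 0" by (simp add: t_def)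
      then have "M \<ge> 0" using tM[of 0] by simp
      then show ?thesis using \<open>card J \<le> n\<close> by (simp add: mult_right_mono)
    qed
    finally show "norm (apply_bcontfun (T g) y) \<le> real n * M + (real N + 1) * \<epsilon>" .
  qed
  moreover have "\<delta> * (real N + 1) \<le> norm (T g)"
    using T(3)[of g] mult_left_mono[OF \<open>real N + 1 \<le> norm g\<close>, of \<delta>] T(4) by linarith
  moreover have "(real N + 1) * \<epsilon> = \<delta> * (real N + 1) / 2" by (simp add: \<epsilon>_def)
  ultimately show ?thesis by linarith
qed

section \<open>Comparison of the eventual cardinalities\<close>

text \<open>The cardinals do not increase and \<open>ordLess\<close> is well-founded, so a minimal
  one is attained and kept from then on.\<close>

lemma eventual_card_cb_deriv:
  fixes X :: "'a::topological_space set"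
  obtains m where "\<And>n. m \<le> n \<Longrightarrow> |cb_deriv X 0 n| =o |cb_deriv X 0 m|"
    "eventual_card (cb_deriv X 0) |cb_deriv X 0 m|"
proof -
  have "range (\<lambda>n. |cb_deriv X 0 n| ) \<noteq> {}" by simp
  then obtain \<kappa> where "\<kappa> \<in> range (\<lambda>n. |cb_deriv X 0 n| )"
    and min: "\<And>\<mu>. (\<mu>, \<kappa>) \<in> ordLess \<Longrightarrow> \<mu> \<notin> range (\<lambda>n. |cb_deriv X 0 n| )"
    using wfE_min'[OF wf_ordLess] by blast
  then obtain m where m: "\<kappa> = |cb_deriv X 0 m|" by blast
  have *: "|cb_deriv X 0 n| =o |cb_deriv X 0 m|" if "m \<le> n" for n
  proof -
    have "|cb_deriv X 0 n| \<le>o |cb_deriv X 0 m|" using cb_deriv_antimono[OF that] by (rule card_of_mono1)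
    moreover have "\<not> |cb_deriv X 0 n| <o |cb_deriv X 0 m|" using min m by blast
    ultimately show ?thesis using ordLeq_iff_ordLess_or_ordIso by blast
  qed
  moreover have "eventual_card (cb_deriv X 0) |cb_deriv X 0 m|"
    unfolding eventual_card_def eventually_sequentially using * by blast
  ultimately show thesis using that by blast
qed

theorem theorem1p6:
  assumes "eberlein_compact TYPE('k1::t2_space) TYPE('x1::banach)"
    and "eberlein_compact TYPE('k2::t2_space) TYPE('x2::banach)"
    and "has_height (UNIV :: 'k1 set) 1 1"
    and "has_height (UNIV :: 'k2 set) 1 1"
    and "\<nexists>F :: 'e::banach set. linearly_homeomorphic c0 F"
    and "\<exists>F :: ('k2 \<Rightarrow>\<^sub>C 'e) set. linearly_homeomorphic (UNIV :: ('k1 \<Rightarrow>\<^sub>C real) set) F"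
  shows "\<exists>\<kappa>1 \<kappa>2.
    eventual_card (\<lambda>n. cb_deriv (UNIV :: 'k1 set) 0 n) \<kappa>1 \<and>
    eventual_card (\<lambda>n. cb_deriv (UNIV :: 'k2 set) 0 n) \<kappa>2 \<and>
    \<kappa>1 \<le>o \<kappa>2"
proof -
  have K1: "compact (UNIV :: 'k1 set)" "scattered (UNIV :: 'k1 set)" and K2: "compact (UNIV :: 'k2 set)"
    using assms(1,2) has_height_scattered[OF assms(3)] by (simp_all add: eberlein_compact_def)
  obtain D :: "nat \<Rightarrow> 'k1 set" where D: "UNIV = (\<Union>n. D n)"
    "\<And>n x. x \<in> D n \<Longrightarrow> \<exists>T. open T \<and> T \<inter> D n = {x}"
    using has_height_discrete_levels[OF assms(3)] by (metis top.extremum_unique)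
  obtain T :: "('k1 \<Rightarrow>\<^sub>C real) \<Rightarrow> ('k2 \<Rightarrow>\<^sub>C 'e)" and \<delta> where T: "bounded_linear T" "\<delta> > 0"
    "\<And>f. \<delta> * norm f \<le> norm (T f)"
    using assms(6) linearly_homeomorphic_UNIV_imp by metis
  obtain M where "\<And>f. norm (T f) \<le> norm f * M" using bounded_linear.bounded[OF T(1)] by blast
  then have M: "\<And>f. norm (T f) \<le> M * norm f" by (simp add: mult.commute)
  obtain n1 where n1: "\<And>n. n1 \<le> n \<Longrightarrow> |cb_deriv (UNIV :: 'k1 set) 0 n| =o |cb_deriv (UNIV :: 'k1 set) 0 n1|"
    "eventual_card (cb_deriv UNIV 0) |cb_deriv (UNIV :: 'k1 set) 0 n1|"
    using eventual_card_cb_deriv by blast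
  obtain n2 where n2: "eventual_card (cb_deriv UNIV 0) |cb_deriv (UNIV :: 'k2 set) 0 n2|"
    using eventual_card_cb_deriv by blast
  define L where "L = cb_deriv (UNIV :: 'k2 set) 0 n2"
  \<comment> \<open>A finite derivative would be followed by an empty one, but height
    \<open>\<omega> + 1\<close> keeps all derivatives of finite order nonempty.\<close>
  have "infinite L"
  proof
    assume "finite L"
    then have "cb_deriv (UNIV :: 'k2 set) 0 (Suc n2) = {}" unfolding L_def by (rule finite_cb_deriv_Suc)
    moreover have "cb_deriv (UNIV :: 'k2 set) 0 (Suc n2) \<noteq> {}"
      using assms(4) unfolding has_height_def by blast
    ultimately show False by blast
  qed
  have "|cb_deriv (UNIV :: 'k1 set) 0 n1| \<le>o |L|"
  proof (rule ccontr)
    assume less: "\<not> |cb_deriv (UNIV :: 'k1 set) 0 n1| \<le>o |L|"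
    have "\<exists>S. countable S \<and> (\<forall>V. clopen V \<longrightarrow> V \<inter> S = {} \<longrightarrow> apply_bcontfun (T (chi V)) y = 0)" for y
    proof -
      have R: "bounded_linear (\<lambda>f. apply_bcontfun (T f) y)"
        by (rule bounded_linear_compose[OF bounded_linear_apply_bcontfun T(1)])
      interpret R: bounded_linear "\<lambda>f. apply_bcontfun (T f) y" by (rule R)
      obtain S where "countable S" "\<And>V. clopen V \<Longrightarrow> V \<inter> S = {} \<Longrightarrow> apply_bcontfun (T (chi V)) y = 0"
      proof (rule exhaustive_countable_support[OF K1, of "\<lambda>V. apply_bcontfun (T (chi V)) y"])
        show "(\<lambda>n. apply_bcontfun (T (chi (V n))) y) \<longlonglongrightarrow> 0"
          if "\<And>n. clopen (V n)" "disjoint_family V" for V :: "nat \<Rightarrow> 'k1 set"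
          using chi_exhaustive_if_no_c0[OF R assms(5) that] .
      qed (auto simp: chi_disjoint_Un R.add)
      then show ?thesis by blast
    qed
    then obtain S where S: "\<And>y. countable (S y)"
      "\<And>y V. clopen V \<Longrightarrow> V \<inter> S y = {} \<Longrightarrow> apply_bcontfun (T (chi V)) y = 0"
      by metis
    have "|\<Union>y\<in>L. S y| \<le>o |L|"
    proof (rule card_of_UNION_ordLeq_infinite[OF \<open>infinite L\<close>])
      show "|L| \<le>o |L|" by (rule card_of_mono1) simp
      show "\<forall>y\<in>L. |S y| \<le>o |L|" using countable_ordLeq_infinite[OF S(1) \<open>infinite L\<close>] by blast
    qed
    then have clS: "|closure (\<Union>y\<in>L. S y)| \<le>o |L|"
      by (intro eberlein_card_of_closure_ordLeq[OF assms(1) D(1) _ _ \<open>infinite L\<close>]) (rule D(2))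
    \<comment> \<open>\<open>N\<close> is large enough to contradict
      \<open>rank_bounded_by_distortion\<close>.\<close>
    obtain N where N: "2 * real n2 * M / \<delta> < real N" using reals_Archimedean2 by blast
    \<comment> \<open>Passing \<open>n1\<close> as well gives this derivative the eventual
      cardinality, too large to fit into the closure.\<close>
    define N' where "N' = max N n1"
    have "\<not> cb_deriv UNIV 0 N' \<subseteq> closure (\<Union>y\<in>L. S y)"
    proof
      assume "cb_deriv UNIV 0 N' \<subseteq> closure (\<Union>y\<in>L. S y)"
      then have "|cb_deriv (UNIV :: 'k1 set) 0 N'| \<le>o |L|"
        using clS card_of_mono1 ordLeq_transitive by blast
      moreover have "|cb_deriv (UNIV :: 'k1 set) 0 n1| =o |cb_deriv (UNIV :: 'k1 set) 0 N'|"
        using n1(1)[of N'] by (simp add: N'_def ordIso_symmetric)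
      ultimately show False using less ordIso_ordLeq_trans by blast
    qed
    then obtain x where x: "x \<in> cb_deriv UNIV 0 N'" "x \<in> - closure (\<Union>y\<in>L. S y)" by blast
    obtain U where U: "clopen U" "x \<in> U" "U \<subseteq> - closure (\<Union>y\<in>L. S y)"
      by (rule scattered_compact_clopen_base[OF K1 _ x(2)]) auto
    have "\<delta> * (real N' + 1) \<le> 2 * real n2 * M"
    proof (rule rank_bounded_by_distortion[OF K1 K2 T(1) M T(3,2) assms(5) U(1)])
      show "U \<inter> cb_deriv UNIV 0 N' \<noteq> {}" using x(1) U(2) by blast
      show "apply_bcontfun (T (chi V)) y = 0"
        if V: "clopen V" "V \<subseteq> U" "y \<in> cb_deriv UNIV 0 n2" for V y
      proof (rule S(2)[OF V(1)])
        have "S y \<subseteq> (\<Union>y\<in>L. S y)" using V(3) by (auto simp: L_def)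
        also have "\<dots> \<subseteq> closure (\<Union>y\<in>L. S y)" by (rule closure_subset)
        finally show "V \<inter> S y = {}" using V(2) U(3) by blast
      qed
    qed
    moreover have "2 * real n2 * M < \<delta> * real N" using N T(2) by (simp add: field_simps)
    moreover have "\<delta> * real N \<le> \<delta> * (real N' + 1)" using T(2) by (simp add: N'_def)
    ultimately show False by linarith
  qed
  with n1(2) n2 show ?thesis unfolding L_def by blast
qed

end
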